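(* Consider the PointQuery problem over a universe $[n]$ in the non-strict turnstile update model, for streams of sparsity $m$. For any pair $(c_a,c_v)$ of positive integers with $c_a\cdot c_v\ge m$, there is an online $(c_a\log n,\ c_v\log n)$-scheme for PointQuery; this scheme is not required to have perfect completeness. Moreover, any online scheme for PointQuery with annotation length $c_a\ge\log n$ and space $c_v$ (and error at most $1/3$) must satisfy $c_a\cdot c_v=\Omega(m\log(n/m))$.
   Context: Data streams: the universe is $[n]=\{0,\dots,n-1\}$. A stream $\mathbf x$ is a sequence of updates $(i,\delta)$ with $i\in[n]$, $\delta\in\mathbb Z$; the frequency of $i$ is $f_i(\mathbf x)=\sum_{(j,\delta)\in\mathbf x:\,j=i}\delta$. In the non-strict turnstile model the $\delta$'s are arbitrary integers. The sparsity $m$ is the number of items with nonzero frequency at the end of the stream. PointQuery: the stream consists of updates $(i,\delta)$ followed by an index $\iota\in[n]$; the goal is to output $f_\iota(\mathbf x)$. Schemes: a scheme for a function $F$ of the stream is a pair $(\mathfrak h,V)$. A prover, using a private random string $r_P$, supplies after the $i$th stream element an annotation string $\mathfrak h_i(\mathbf x,r_P)\in\{0,1\}^*$; the verifier $V$ is a streaming algorithm with $w$ bits of working memory and a private random string $r_V$ that reads the interleaved stream $(x_1,\mathfrak h_1,x_2,\mathfrak h_2,\dots)$ and outputs a value or $\bot$ (reject). Completeness error $\delta_c$: for every input $\mathbf x$, $\Pr_{r_P,r_V}[\text{output}\ne F(\mathbf x)]\le\delta_c$ (perfect completeness if $\delta_c=0$). Soundness error $\delta_s$: for every $\mathbf x$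 and every annotation sequence $\mathfrak h'$, $\Pr_{r_V}[\text{output}\notin\{F(\mathbf x),\bot\}]\le\delta_s$. The error is the least $\max\{\delta_s,\delta_c\}$. The annotation length is $\max_{\mathbf x,r_P}\sum_i|\mathfrak h_i(\mathbf x,r_P)|$ and the space is $w$. An online $(c_a,c_v)$-scheme is a scheme with annotation length $O(c_a)$, space $O(c_v)$, error at most $1/3$, in which each $\mathfrak h_i$ depends only on $x_1,\dots,x_i$ and $r_P$.
   Formalization: For the schemes' existence, final frequencies are assumed at most n^k in absolute value (any fixed k, hidden constant depending on k) and n ≥ 2; with unbounded integer frequencies no scheme with O(c_v log n) bits of space could output all possible answers. *)

theory Defs
  imports "HOL-Probability.Probability"
begin

section \<open>Annotated streams and schemes\<close>

text \<open>The verifier reads the interleaved stream \<open>x\<^sub>1, h\<^sub>1, x\<^sub>2, h\<^sub>2, \<dots>\<close> one token at a time; an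
  annotation string arrives bit by bit.\<close>

datatype 'x token = Elem 'x | Annot bool

definition interleave :: "'x list \<Rightarrow> bool list list \<Rightarrow> 'x token list" where
  "interleave xs as = concat (map2 (\<lambda>x a. Elem x # map Annot a) xs as)"

text \<open>\<open>annotation S x r i\<close> is the string supplied directly after the element \<open>x ! i\<close> by the prover
  with random string \<open>r\<close>. The verifier's random string is the first argument of
  \<open>start\<close>, \<open>step\<close> and \<open>answer\<close>; it is not charged to the working memory, which has \<open>memory S\<close>
  bits. An answer of \<open>None\<close> means rejection.\<close>

record ('x, 'o) scheme =
  prover_coins :: nat
  verifier_coins :: nat
  memory :: nat
  annotation :: "'x list \<Rightarrow> bool list \<Rightarrow> nat \<Rightarrow> bool list"
  start :: "bool list \<Rightarrow> bool list"
  step :: "bool list \<Rightarrow> bool list \<Rightarrow> 'x token \<Rightarrow> bool list"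
  answer :: "bool list \<Rightarrow> bool list \<Rightarrow> 'o option"

definition bitstrings :: "nat \<Rightarrow> bool list set" where
  "bitstrings l = {r. length r = l}"

definition coins :: "nat \<Rightarrow> bool list pmf" where
  "coins l = pmf_of_set (bitstrings l)"

definition respects_space :: "('x, 'o) scheme \<Rightarrow> bool" where
  "respects_space S \<longleftrightarrow>
     (\<forall>r \<in> bitstrings (verifier_coins S).
        start S r \<in> bitstrings (memory S) \<and>
        (\<forall>s \<in> bitstrings (memory S). \<forall>t. step S r s t \<in> bitstrings (memory S)))"

definition run :: "('x, 'o) scheme \<Rightarrow> bool list \<Rightarrow> 'x list \<Rightarrow> bool list list \<Rightarrow> 'o option" where
  "run S r x as = answer S r (foldl (step S r) (start S r) (interleave x as))"

definition honest :: "('x, 'o) scheme \<Rightarrow> 'x list \<Rightarrow> bool list \<Rightarrow> bool list list" where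
  "honest S x r = map (annotation S x r) [0..<length x]"

text \<open>In the following, \<open>D\<close> is the set of admissible inputs and \<open>F\<close> the function to be computed
  on them.\<close>

definition completeness_error_le ::
    "('x, 'o) scheme \<Rightarrow> 'x list set \<Rightarrow> ('x list \<Rightarrow> 'o) \<Rightarrow> real \<Rightarrow> bool" where
  "completeness_error_le S D F \<epsilon> \<longleftrightarrow>
     (\<forall>x \<in> D. measure_pmf.prob (pair_pmf (coins (prover_coins S)) (coins (verifier_coins S)))
        {(p, r). run S r x (honest S x p) \<noteq> Some (F x)} \<le> \<epsilon>)"

definition soundness_error_le ::
    "('x, 'o) scheme \<Rightarrow> 'x list set \<Rightarrow> ('x list \<Rightarrow> 'o) \<Rightarrow> real \<Rightarrow> bool" where
  "soundness_error_le S D F \<epsilon> \<longleftrightarrow>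
     (\<forall>x \<in> D. \<forall>as. length as = length x \<longrightarrow>
        measure_pmf.prob (coins (verifier_coins S))
          {r. run S r x as \<notin> {Some (F x), None}} \<le> \<epsilon>)"

definition annotation_length_le :: "('x, 'o) scheme \<Rightarrow> 'x list set \<Rightarrow> real \<Rightarrow> bool" where
  "annotation_length_le S D a \<longleftrightarrow>
     (\<forall>x \<in> D. \<forall>p \<in> bitstrings (prover_coins S).
        real (\<Sum>i<length x. length (annotation S x p i)) \<le> a)"

definition online :: "('x, 'o) scheme \<Rightarrow> 'x list set \<Rightarrow> bool" where
  "online S D \<longleftrightarrow>
     (\<forall>x \<in> D. \<forall>y \<in> D. \<forall>p \<in> bitstrings (prover_coins S). \<forall>i.
        i < length x \<and> i < length y \<and> take (Suc i) x = take (Suc i) y \<longrightarrow>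
        annotation S x p i = annotation S y p i)"

text \<open>Here \<open>a\<close> and \<open>w\<close> are bounds without hidden constants.\<close>

definition online_scheme ::
    "('x, 'o) scheme \<Rightarrow> 'x list set \<Rightarrow> ('x list \<Rightarrow> 'o) \<Rightarrow> real \<Rightarrow> real \<Rightarrow> bool" where
  "online_scheme S D F a w \<longleftrightarrow>
     respects_space S \<and> online S D \<and>
     completeness_error_le S D F (1/3) \<and> soundness_error_le S D F (1/3) \<and>
     annotation_length_le S D a \<and> real (memory S) \<le> w"

section \<open>Point queries in the non-strict turnstile model\<close>

datatype pq_elem = Update nat int | Query nat

fun weight :: "nat \<Rightarrow> pq_elem \<Rightarrow> int" where
  "weight i (Update j \<delta>) = (if j = i then \<delta> else 0)"
| "weight i (Query j) = 0"

definition freq :: "pq_elem list \<Rightarrow> nat \<Rightarrow> int" where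
  "freq x i = (\<Sum>e\<leftarrow>x. weight i e)"

definition sparsity :: "pq_elem list \<Rightarrow> nat" where
  "sparsity x = card {i. freq x i \<noteq> 0}"

text \<open>The increments are arbitrary integers, but the final frequencies are bounded by \<open>B\<close>
  in absolute value: without such a bound (polynomial in \<open>n\<close>), a frequency could not be
  written down in \<open>O(log n)\<close> bits.\<close>

definition pq_inputs :: "nat \<Rightarrow> nat \<Rightarrow> pq_elem list set" where
  "pq_inputs n B =
     {map (\<lambda>(i, \<delta>). Update i \<delta>) us @ [Query \<iota>] | us \<iota>. fst ` set us \<subseteq> {..<n} \<and> \<iota> < n} \<inter>
     {x. \<forall>i. \<bar>freq x i\<bar> \<le> int B}"

text \<open>The value on streams that do not end in a query is irrelevant.\<close>

definition point_query :: "pq_elem list \<Rightarrow> int" where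
  "point_query x = (case last x of Query \<iota> \<Rightarrow> freq x \<iota> | Update _ _ \<Rightarrow> 0)"

end

(* LOWER BOUND. Feed the scheme the indicator stream of a set X of m items. Run it with one prover
   string and O(ca) independent verifier strings, and let the decoder, who sees only the resulting
   memory contents, try every annotation that could follow the query: an item is decoded when some
   annotation makes half of the copies answer 1. The exponentially small majority error absorbs the
   union bound over the 2^O(ca) annotations and, since ca >= log n, over all n items, so that no
   item outside X is decoded; by completeness a constant fraction of X is decoded on average. The
   memory contents thus confine X to the supersets of a set of m/6 items, which costs
   (m/6) log(n/m) bits.

   UPPER BOUND. The prover's random string is a hash key for about cv buckets, sent right after the
   first stream element. The verifier keeps one random linear fingerprint modulo 6 n^k + 1 per
   bucket. After the query the prover lists the nonzero frequencies in the bucket of the queried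
   item, of which there are O(ca) with probability at least 2/3; a false value at the queried
   item passes the fingerprint test with probability at most 1/4. *)

theory Submission
  imports Defs
begin

section \<open>Coins, streams and counting\<close>

text \<open>With a single prover string for all copies, one query annotation can be tested against
  all of them. Independent prover strings would call for a tuple of annotations, and the union bound
  would then outgrow what a majority over that many copies can absorb. The price is that only
  soundness is amplified: completeness is known only on average over both strings, so an item of X
  may be lost with constant probability, and counting supersets of a partial set replaces exact
  recovery. Onlineness makes the memory before the query independent of the queried item, so one
  message serves all items. In the upper bound the key comes from the prover, because the verifier's
  coins are private and the prover must know the buckets. A dishonest key does no harm: soundness
  holds for every key, since the vector to be fingerprinted depends on the tokens read and not on
  the verifier's coins. A bad key can only spoil completeness, which is why that is imperfect. Hash
  and fingerprint avoid primes: keys are \<open>L\<close>-bit numbers, and only the integers 1, 2, 3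
  up to sign have to be invertible.\<close>

lemma bitstrings_eq: "bitstrings l = {r. set r \<subseteq> UNIV \<and> length r = l}"
  by (simp add: bitstrings_def)

lemma finite_bitstrings [simp]: "finite (bitstrings l)"
  unfolding bitstrings_eq by (rule finite_lists_length_eq) simp

lemma card_bitstrings [simp]: "card (bitstrings l) = 2 ^ l"
  unfolding bitstrings_eq by (subst card_lists_length_eq) simp_all

lemma bitstrings_nonempty [simp]: "bitstrings l \<noteq> {}"
  by (metis card.empty card_bitstrings power_not_zero zero_neq_numeral)

lemma prob_coins: "measure_pmf.prob (coins l) E = real (card {r \<in> bitstrings l. r \<in> E}) / 2 ^ l"
  unfolding coins_def by (simp add: measure_pmf_of_set Int_def conj_commute)

lemma prob_coins_pair:
  "measure_pmf.prob (pair_pmf (coins k) (coins l)) E =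
     real (card {z \<in> bitstrings k \<times> bitstrings l. z \<in> E}) / (2 ^ k * 2 ^ l)"
proof -
  have "pair_pmf (coins k) (coins l) = pmf_of_set (bitstrings k \<times> bitstrings l)"
    unfolding coins_def
  proof (rule pmf_eqI)
    fix z :: "bool list \<times> bool list"
    show "pmf (pair_pmf (pmf_of_set (bitstrings k)) (pmf_of_set (bitstrings l))) z =
        pmf (pmf_of_set (bitstrings k \<times> bitstrings l)) z"
      by (cases z) (simp add: pmf_pair indicator_def card_cartesian_product)
  qed
  then show ?thesis
    by (simp add: measure_pmf_of_set card_cartesian_product Int_def conj_commute)
qed

lemma interleave_append:
  assumes "length xs = length as"
  shows "interleave (xs @ ys) (as @ bs) = interleave xs as @ interleave ys bs"
  using assms by (simp add: interleave_def)

lemma interleave_simps [simp]: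
  "interleave [] as = []"
  "interleave (x # xs) (a # as) = Elem x # map Annot a @ interleave xs as"
  by (simp_all add: interleave_def)

lemma freq_Nil [simp]: "freq [] i = 0"
  by (simp add: freq_def)

lemma freq_append: "freq (xs @ ys) i = freq xs i + freq ys i"
  by (simp add: freq_def)

lemma freq_Cons: "freq (e # xs) i = weight i e + freq xs i"
  by (simp add: freq_def)

text \<open>One coordinate is constrained and the others are free, so the event keeps its density in
  the product. Multiplying by \<open>card R\<close> avoids the exponent
  \<open>K - 1\<close>.\<close>

lemma card_tuples_coord:
  fixes R :: "'a set"
  assumes "finite R" "E \<subseteq> R" "k < K"
  shows "card {\<rho> \<in> {..<K} \<rightarrow>\<^sub>E R. \<rho> k \<in> E} * card R = card E * card R ^ K"
proof -
  have "{\<rho> \<in> {..<K} \<rightarrow>\<^sub>E R. \<rho> k \<in> E} = Pi\<^sub>E {..<K} (\<lambda>i. if i = k then E else R)"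
  proof (intro equalityI subsetI)
    fix \<rho> assume \<rho>: "\<rho> \<in> Pi\<^sub>E {..<K} (\<lambda>i. if i = k then E else R)"
    then have "\<rho> i \<in> (if i = k then E else R)" if "i < K" for i
      using PiE_mem[of \<rho> "{..<K}"] that by blast
    then have "\<rho> k \<in> E" "\<And>i. i < K \<Longrightarrow> \<rho> i \<in> R"
      using assms by (metis, metis subsetD)
    with \<rho> show "\<rho> \<in> {\<rho> \<in> {..<K} \<rightarrow>\<^sub>E R. \<rho> k \<in> E}" by (simp add: PiE_iff)
  qed (auto simp: PiE_iff)
  then have "card {\<rho> \<in> {..<K} \<rightarrow>\<^sub>E R. \<rho> k \<in> E} = (\<Prod>i<K. card (if i = k then E else R))"
    by (simp add: card_PiE)
  also have "\<dots> = card E * (\<Prod>i\<in>{..<K} - {k}. card R)"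
    using assms by (subst prod.remove[of _ k]) (auto intro!: prod.cong)
  also have "\<dots> = card E * card R ^ (K - 1)"
    using assms by simp
  finally show ?thesis
    using assms by (cases K) (simp_all add: mult.assoc mult.commute)
qed

text \<open>Markov's inequality for \<open>2\<close> to the power of the number of hits.\<close>

lemma card_majority_le:
  fixes R :: "'a set"
  assumes fin: "finite R" and E: "E \<subseteq> R" "3 * card E \<le> card R"
  shows "real (card {\<rho> \<in> {..<2 * J} \<rightarrow>\<^sub>E R. J \<le> card {k. k < 2 * J \<and> \<rho> k \<in> E}})
           \<le> (8 / 9) ^ J * real (card R) ^ (2 * J)"
proof -
  let ?T = "{..<2 * J} \<rightarrow>\<^sub>E R"
  let ?f = "\<lambda>r. if r \<in> E then 2 else 1 :: real"
  let ?hits = "\<lambda>\<rho>. card {k. k < 2 * J \<and> \<rho> k \<in> E}"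
  let ?B = "{\<rho> \<in> ?T. J \<le> ?hits \<rho>}"
  have finT: "finite ?T" using fin by (simp add: finite_PiE)
  have pw: "(\<Prod>k<2 * J. ?f (\<rho> k)) = 2 ^ ?hits \<rho>" for \<rho> :: "nat \<Rightarrow> 'a"
    by (simp add: prod.If_cases Int_def conj_commute)
  have "real (card ?B) * 2 ^ J = (\<Sum>\<rho>\<in>?B. 2 ^ J)"
    by simp
  also have "\<dots> \<le> (\<Sum>\<rho>\<in>?B. 2 ^ ?hits \<rho>)"
    by (intro sum_mono power_increasing) auto
  also have "\<dots> \<le> (\<Sum>\<rho>\<in>?T. 2 ^ ?hits \<rho>)"
    using finT by (intro sum_mono2) auto
  also have "\<dots> = (\<Sum>\<rho>\<in>?T. \<Prod>k<2 * J. ?f (\<rho> k))"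
    by (simp only: pw)
  also have "\<dots> = (\<Prod>k<2 * J. \<Sum>r\<in>R. ?f r)"
    using fin by (subst prod_sum_PiE) auto
  also have "\<dots> = (\<Sum>r\<in>R. ?f r) ^ (2 * J)"
    by simp
  also have "(\<Sum>r\<in>R. ?f r) = real (card R) + real (card E)"
  proof -
    have "(\<Sum>r\<in>R. ?f r) = (\<Sum>r\<in>R. 1 + of_bool (r \<in> E))"
      by (intro sum.cong) auto
    also have "\<dots> = real (card R) + real (card (R \<inter> E))"
      using fin by (simp add: sum.distrib Int_def)
    finally show ?thesis using E by (simp add: Int_absorb1)
  qed
  \<comment> \<open>A draw from \<open>R\<close> has weight at most 4/3 on average, hence (16/9)^J
    over 2J draws; against the threshold 2^J this leaves (8/9)^J.\<close>
  also have "(real (card R) + real (card E)) ^ (2 * J) \<le> (4 / 3 * real (card R)) ^ (2 * J)"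
    using E by (intro power_mono) linarith+
  also have "\<dots> = (16 / 9) ^ J * real (card R) ^ (2 * J)"
    unfolding power_mult_distrib power_mult[of "4 / 3 :: real"] by (simp add: power2_eq_square)
  also have "\<dots> = (8 / 9) ^ J * real (card R) ^ (2 * J) * 2 ^ J"
  proof -
    have "(16 / 9 :: real) = 8 / 9 * 2" by simp
    then have "(16 / 9 :: real) ^ J = (8 / 9) ^ J * 2 ^ J"
      by (simp only: power_mult_distrib)
    then show ?thesis by (simp only: mult.assoc mult.commute mult.left_commute)
  qed
  finally show ?thesis by simp
qed

text \<open>Each further element forced into an m-subset divides the number of choices by (n - y) /
  (m - y), which is at least n / m because m \<le> n; at least m/6 forced elements gain the stated
  power.\<close>

lemma card_supersets_le:
  assumes Y: "Y \<subseteq> {..<n::nat}" and m: "0 < m" "m \<le> n" and y: "real m / 6 \<le> real (card Y)"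
  shows "real (card {X. X \<subseteq> {..<n} \<and> card X = m \<and> Y \<subseteq> X}) * (real n / real m) powr (real m / 6)
     \<le> real (n choose m)"
proof (cases "card Y \<le> m")
  case False
  have "{X. X \<subseteq> {..<n} \<and> card X = m \<and> Y \<subseteq> X} = {}"
    using False by (auto dest: card_mono[OF finite_subset[OF _ finite_lessThan]])
  then show ?thesis by (simp only:) simp
next
  case True
  have fin: "finite Y" using Y finite_subset by blast
  let ?Xs = "{X. X \<subseteq> {..<n} \<and> card X = m \<and> Y \<subseteq> X}"
  let ?Zs = "{Z. Z \<subseteq> {..<n} - Y \<and> card Z = m - card Y}"
  have "card ?Xs \<le> card ?Zs"
  proof (rule card_inj_on_le[where f = "\<lambda>X. X - Y"])
    show "inj_on (\<lambda>X. X - Y) ?Xs" by (auto simp: inj_on_def)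
    show "(\<lambda>X. X - Y) ` ?Xs \<subseteq> ?Zs" using fin by (auto simp: card_Diff_subset)
    show "finite ?Zs" by (rule finite_subset[of _ "Pow {..<n}"]) auto
  qed
  also have "card ?Zs = (n - card Y) choose (m - card Y)"
    using Y fin by (simp add: n_subsets card_Diff_subset)
  finally have 1: "card ?Xs \<le> (n - card Y) choose (m - card Y)" .
  have q: "1 \<le> real n / real m" using m by simp
  have 2: "real ((n - y) choose (m - y)) * (real n / real m) ^ y \<le> real (n choose m)" if "y \<le> m" for y
    using that
  proof (induction y)
    case (Suc y)
    define N M where "N = n - Suc y" and "M = m - Suc y"
    have NM: "n - y = Suc N" "m - y = Suc M" using Suc.prems m by (auto simp: N_def M_def)
    have "Suc N * (N choose M) = (Suc N choose Suc M) * Suc M"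
      by (rule Suc_times_binomial_eq)
    then have eq: "real (Suc N) * real (N choose M) = real (Suc N choose Suc M) * real (Suc M)"
      by (metis of_nat_mult)
    have "real n * real y \<ge> real m * real y" using m by (intro mult_right_mono) auto
    then have "real n * (real m - real y) \<le> real m * (real n - real y)" by (simp add: algebra_simps)
    moreover have "real (Suc M) = real m - real y" "real (Suc N) = real n - real y"
      using Suc.prems m by (simp_all add: N_def M_def of_nat_diff)
    ultimately have "real n / real m \<le> real (Suc N) / real (Suc M)"
      using m by (simp add: pos_le_divide_eq pos_divide_le_eq mult.commute del: of_nat_Suc)
    then have "real (N choose M) * (real n / real m) \<le> real (N choose M) * (real (Suc N) / real (Suc M))"
      by (intro mult_left_mono) auto
    also have "\<dots> = real (Suc N choose Suc M)"
      using eq by (simp add: field_simps del: of_nat_Suc binomial_Suc_Suc)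
    finally have "real (N choose M) * (real n / real m) * (real n / real m) ^ y
        \<le> real (Suc N choose Suc M) * (real n / real m) ^ y"
      by (intro mult_right_mono) auto
    moreover have "real (Suc N choose Suc M) * (real n / real m) ^ y \<le> real (n choose m)"
      using Suc NM by simp
    ultimately show ?case
      unfolding N_def[symmetric] M_def[symmetric] power_Suc mult.assoc[symmetric] by linarith
  qed simp
  have "real (card ?Xs) * (real n / real m) powr (real m / 6)
      \<le> real ((n - card Y) choose (m - card Y)) * (real n / real m) powr real (card Y)"
    using 1 y q by (intro mult_mono powr_mono) auto
  also have "\<dots> = real ((n - card Y) choose (m - card Y)) * (real n / real m) ^ card Y"
    using q m by (simp add: powr_realpow)
  also have "\<dots> \<le> real (n choose m)" by (rule 2[OF True])
  finally show ?thesis .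
qed

section \<open>Decoding a sparse set from few bits\<close>

text \<open>The encoding argument freed from streams: \<open>p\<close> and \<open>r\<close> are
  prover and verifier strings, \<open>st X p r\<close> is the memory before the query,
  \<open>acc\<close> says that the answer is 1, \<open>B\<close> holds the candidate query
  annotations and \<open>b\<close> is the honest one. Since \<open>b\<close> may depend on
  \<open>p\<close> but not on \<open>r\<close>, the same candidate can be tried on all
  copies.\<close>

lemma decoding_bound:
  fixes st :: "nat set \<Rightarrow> 'p \<Rightarrow> 'r \<Rightarrow> 's" and acc :: "'r \<Rightarrow> 's \<Rightarrow> nat \<Rightarrow> 'b \<Rightarrow> bool"
    and b :: "nat set \<Rightarrow> 'p \<Rightarrow> nat \<Rightarrow> 'b"
  defines "\<Omega> n m \<equiv> {X. X \<subseteq> {..<n} \<and> card X = m}"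
  assumes P: "finite P" "P \<noteq> {}" and R: "finite R" "R \<noteq> {}" and W: "finite W" and B: "finite B"
    and m: "0 < m" "m \<le> n" and J: "0 < J" "real n * real (card B) * (8 / 9) ^ J \<le> 1 / 10"
    and st: "\<And>X p r. X \<in> \<Omega> n m \<Longrightarrow> p \<in> P \<Longrightarrow> r \<in> R \<Longrightarrow> st X p r \<in> W"
    and sound: "\<And>X p \<iota> \<beta>. X \<in> \<Omega> n m \<Longrightarrow> p \<in> P \<Longrightarrow> \<iota> < n \<Longrightarrow> \<iota> \<notin> X \<Longrightarrow>
       \<beta> \<in> B \<Longrightarrow> 3 * card {r \<in> R. acc r (st X p r) \<iota> \<beta>} \<le> card R"
    and b: "\<And>X p \<iota>. X \<in> \<Omega> n m \<Longrightarrow> p \<in> P \<Longrightarrow> \<iota> \<in> X \<Longrightarrow> b X p \<iota> \<in> B"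
    and complete: "\<And>X \<iota>. X \<in> \<Omega> n m \<Longrightarrow> \<iota> \<in> X \<Longrightarrow>
       3 * card {(p, r) \<in> P \<times> R. \<not> acc r (st X p r) \<iota> (b X p \<iota>)} \<le> card P * card R"
  shows "(real n / real m) powr (real m / 6) \<le> 15 * real (card W) ^ (2 * J)"
proof -
  define K where "K = 2 * J"
  define T where "T = {..<K} \<rightarrow>\<^sub>E R"
  define msg where "msg X p \<rho> = (\<lambda>k\<in>{..<K}. st X p (\<rho> k))" for X p and \<rho> :: "nat \<Rightarrow> 'r"
  \<comment> \<open>The decoder: it uses the verifier strings and the stored states only, neither
    \<open>X\<close> nor \<open>p\<close>. With \<open>K = 2 * J\<close>, the threshold
    \<open>J\<close> is half of the copies.\<close>
  define Y where "Y \<rho> s = {\<iota>. \<iota> < n \<and> (\<exists>\<beta>\<in>B. J \<le> card {k. k < K \<and> acc (\<rho> k) (s k) \<iota> \<beta>})}"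
    for \<rho> :: "nat \<Rightarrow> 'r" and s :: "nat \<Rightarrow> 's"
  define good where "good X p \<rho> \<longleftrightarrow> Y \<rho> (msg X p \<rho>) \<subseteq> X \<and> real m / 6 \<le> real (card (Y \<rho> (msg X p \<rho>)))"
    for X p and \<rho> :: "nat \<Rightarrow> 'r"
  have finT: "finite T" using R by (simp add: T_def finite_PiE)
  have cardT: "card T = card R ^ K" by (simp add: T_def card_PiE)
  have R0: "0 < card R" and P0: "0 < card P" using P R by (simp_all add: card_gt_0_iff)
  have T0: "0 < card T" using R0 cardT by simp
  have Y_msg: "Y \<rho> (msg X p \<rho>) =
      {\<iota>. \<iota> < n \<and> (\<exists>\<beta>\<in>B. J \<le> card {k. k < K \<and> acc (\<rho> k) (st X p (\<rho> k)) \<iota> \<beta>})}" for \<rho> X p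
    unfolding Y_def msg_def by (simp cong: conj_cong)
  have finY: "finite (Y \<rho> s)" for \<rho> s unfolding Y_def by simp
  have \<Omega>: "finite (\<Omega> n m)" "card (\<Omega> n m) = n choose m"
    unfolding \<Omega>_def by (auto simp: n_subsets intro: finite_subset[of _ "Pow {..<n}"])

  have unsound: "real (card {\<rho> \<in> T. \<not> Y \<rho> (msg X p \<rho>) \<subseteq> X}) \<le> real (card T) / 10"
    if X: "X \<in> \<Omega> n m" and p: "p \<in> P" for X p
  proof -
    define E where "E = (\<lambda>(\<iota>, \<beta>). {r \<in> R. acc r (st X p r) \<iota> \<beta>})"
    let ?I = "({..<n} - X) \<times> B"
    let ?M = "\<lambda>z. {\<rho> \<in> T. J \<le> card {k. k < K \<and> \<rho> k \<in> E z}}"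
    have "{\<rho> \<in> T. \<not> Y \<rho> (msg X p \<rho>) \<subseteq> X} \<subseteq> (\<Union>z\<in>?I. ?M z)"
    proof
      fix \<rho> assume "\<rho> \<in> {\<rho> \<in> T. \<not> Y \<rho> (msg X p \<rho>) \<subseteq> X}"
      then obtain \<iota> \<beta> where *: "\<rho> \<in> T" "\<iota> < n" "\<iota> \<notin> X" "\<beta> \<in> B"
        "J \<le> card {k. k < K \<and> acc (\<rho> k) (st X p (\<rho> k)) \<iota> \<beta>}"
        unfolding Y_msg by blast
      have "{k. k < K \<and> acc (\<rho> k) (st X p (\<rho> k)) \<iota> \<beta>} = {k. k < K \<and> \<rho> k \<in> E (\<iota>, \<beta>)}"
        using * by (auto simp: E_def T_def PiE_iff)
      with * have "(\<iota>, \<beta>) \<in> ?I" "\<rho> \<in> ?M (\<iota>, \<beta>)" by auto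
      then show "\<rho> \<in> (\<Union>z\<in>?I. ?M z)" by blast
    qed
    then have "card {\<rho> \<in> T. \<not> Y \<rho> (msg X p \<rho>) \<subseteq> X} \<le> card (\<Union>z\<in>?I. ?M z)"
      using finT B by (intro card_mono) auto
    also have "\<dots> \<le> (\<Sum>z\<in>?I. card (?M z))"
      using B by (intro card_UN_le) auto
    finally have "real (card {\<rho> \<in> T. \<not> Y \<rho> (msg X p \<rho>) \<subseteq> X}) \<le> (\<Sum>z\<in>?I. real (card (?M z)))"
      unfolding of_nat_sum[symmetric] of_nat_le_iff .
    also have "\<dots> \<le> (\<Sum>z\<in>?I. (8 / 9) ^ J * real (card T))"
    proof (rule sum_mono)
      fix z assume z: "z \<in> ?I"
      have "E z \<subseteq> R" "3 * card (E z) \<le> card R"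
        using z sound[OF X p] by (auto simp: E_def)
      from card_majority_le[OF R(1) this, of J]
      show "real (card (?M z)) \<le> (8 / 9) ^ J * real (card T)"
        by (simp add: T_def K_def cardT[unfolded T_def K_def])
    qed
    also have "\<dots> = real (card ({..<n} - X)) * real (card B) * (8 / 9) ^ J * real (card T)"
      by (simp add: card_cartesian_product)
    also have "\<dots> \<le> real n * real (card B) * (8 / 9) ^ J * real (card T)"
      using card_mono[of "{..<n}" "{..<n} - X"] by (intro mult_right_mono) auto
    also have "\<dots> \<le> 1 / 10 * real (card T)"
      using J by (intro mult_right_mono) auto
    finally show ?thesis by simp
  qed

  \<comment> \<open>Markov's inequality: a pair that misses the item has at least \<open>J\<close>
    failing copies, while the average number of failures is at most K/3 = 2J/3. Only averages enter,
    so the copies may share \<open>p\<close>.\<close>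
  have missed: "3 * real (card {(p, \<rho>) \<in> P \<times> T. \<iota> \<notin> Y \<rho> (msg X p \<rho>)}) \<le> 2 * (real (card P) * real (card T))"
    if X: "X \<in> \<Omega> n m" and \<iota>: "\<iota> \<in> X" for X \<iota>
  proof -
    define F where "F p = {r \<in> R. \<not> acc r (st X p r) \<iota> (b X p \<iota>)}" for p
    have \<iota>n: "\<iota> < n" using X \<iota> by (auto simp: \<Omega>_def)
    let ?M = "{(p, \<rho>) \<in> P \<times> T. \<iota> \<notin> Y \<rho> (msg X p \<rho>)}"
    have finM: "finite ?M" using finT P by (auto intro: finite_subset[of _ "P \<times> T"])
    have "J * card ?M = (\<Sum>z\<in>?M. J)" by simp
    also have "\<dots> \<le> (\<Sum>(p, \<rho>)\<in>?M. card {k. k < K \<and> \<rho> k \<in> F p})"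
    proof (rule sum_mono, clarify)
      fix p \<rho> assume p: "p \<in> P" and \<rho>: "\<rho> \<in> T" and nY: "\<iota> \<notin> Y \<rho> (msg X p \<rho>)"
      let ?S = "{k. k < K \<and> acc (\<rho> k) (st X p (\<rho> k)) \<iota> (b X p \<iota>)}"
      have "card ?S < J" using nY b[OF X p \<iota>] \<iota>n unfolding Y_msg by force
      moreover have "{k. k < K \<and> \<rho> k \<in> F p} = {..<K} - ?S"
        using \<rho> by (auto simp: F_def T_def PiE_iff)
      moreover have "card ({..<K} - ?S) = K - card ?S" by (subst card_Diff_subset) auto
      ultimately show "J \<le> card {k. k < K \<and> \<rho> k \<in> F p}" by (simp add: K_def)
    qed
    also have "\<dots> \<le> (\<Sum>(p, \<rho>)\<in>P \<times> T. card {k. k < K \<and> \<rho> k \<in> F p})"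
      using finT P by (intro sum_mono2) auto
    also have "\<dots> = (\<Sum>p\<in>P. \<Sum>\<rho>\<in>T. \<Sum>k<K. of_bool (\<rho> k \<in> F p))"
      by (simp add: sum.cartesian_product Int_def conj_commute)
    also have "\<dots> = (\<Sum>p\<in>P. \<Sum>k<K. \<Sum>\<rho>\<in>T. of_bool (\<rho> k \<in> F p))"
      by (intro sum.cong refl sum.swap)
    also have "\<dots> = (\<Sum>p\<in>P. \<Sum>k<K. card {\<rho> \<in> T. \<rho> k \<in> F p})"
      using finT by (simp add: Int_def)
    finally have "J * card ?M * card R \<le> (\<Sum>p\<in>P. \<Sum>k<K. card {\<rho> \<in> T. \<rho> k \<in> F p}) * card R"
      by simp
    also have "\<dots> = (\<Sum>p\<in>P. \<Sum>k<K. card {\<rho> \<in> T. \<rho> k \<in> F p} * card R)"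
      by (simp add: sum_distrib_right)
    also have "\<dots> = (\<Sum>p\<in>P. \<Sum>k<K. card (F p) * card R ^ K)"
      unfolding T_def using R by (intro sum.cong refl card_tuples_coord) (auto simp: F_def)
    also have "\<dots> = K * card T * (\<Sum>p\<in>P. card (F p))"
      by (simp add: cardT sum_distrib_left sum_distrib_right mult_ac)
    also have "(\<Sum>p\<in>P. card (F p)) = card (SIGMA p:P. F p)"
      using P R by (simp add: F_def)
    also have "(SIGMA p:P. F p) = {(p, r) \<in> P \<times> R. \<not> acc r (st X p r) \<iota> (b X p \<iota>)}"
      by (auto simp: F_def)
    finally have "3 * (J * card ?M * card R) \<le> K * card T * (3 * card {(p, r) \<in> P \<times> R. \<not> acc r (st X p r) \<iota> (b X p \<iota>)})"
      by simp
    also have "\<dots> \<le> K * card T * (card P * card R)"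
      by (intro mult_left_mono complete X \<iota>) auto
    finally have "(J * card R) * (3 * card ?M) \<le> (J * card R) * (2 * (card P * card T))"
      by (simp add: K_def mult_ac)
    then have "3 * card ?M \<le> 2 * (card P * card T)"
      using J(1) R0 by (simp only: mult_le_cancel1) simp
    from of_nat_mono[OF this, where 'a = real] show ?thesis
      by (simp only: of_nat_mult of_nat_numeral)
  qed

  \<comment> \<open>On average at least m/3 elements of \<open>X\<close> are decoded, and never more
    than m; hence at least 1/6 of the pairs decode m/6 of them. Removing the at most 1/10 of pairs
    with a false item leaves 1/6 - 1/10 = 1/15.\<close>
  have good_many: "real (card P) * real (card T) / 15 \<le> real (card {(p, \<rho>) \<in> P \<times> T. good X p \<rho>})"
    if X: "X \<in> \<Omega> n m" for X
  proof -
    have Xm: "finite X" "card X = m" "X \<subseteq> {..<n}"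
      using X by (auto simp: \<Omega>_def intro: finite_subset)
    let ?N = "real (card P) * real (card T)"
    let ?Y = "\<lambda>(p, \<rho>). Y \<rho> (msg X p \<rho>)"
    let ?U = "P \<times> T"
    have finU: "finite ?U" using finT P by simp
    define U1 where "U1 = {z \<in> ?U. \<not> ?Y z \<subseteq> X}"
    define U2 where "U2 = {z \<in> ?U. real m / 6 \<le> real (card (?Y z \<inter> X))}"
    define G where "G = {(p, \<rho>) \<in> P \<times> T. good X p \<rho>}"
    have cU: "real (card ?U) = ?N" by (simp add: card_cartesian_product)
    have "U1 = (SIGMA p:P. {\<rho> \<in> T. \<not> Y \<rho> (msg X p \<rho>) \<subseteq> X})" by (auto simp: U1_def)
    then have "real (card U1) = (\<Sum>p\<in>P. real (card {\<rho> \<in> T. \<not> Y \<rho> (msg X p \<rho>) \<subseteq> X}))"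
      using P finT by simp
    also have "\<dots> \<le> (\<Sum>p\<in>P. real (card T) / 10)"
      by (intro sum_mono unsound X)
    finally have U1: "real (card U1) \<le> ?N / 10" by simp
    have hit: "?N / 3 \<le> real (card {z \<in> ?U. \<iota> \<in> ?Y z})" if "\<iota> \<in> X" for \<iota>
    proof -
      have "{z \<in> ?U. \<iota> \<in> ?Y z} = ?U - {(p, \<rho>) \<in> P \<times> T. \<iota> \<notin> Y \<rho> (msg X p \<rho>)}" by auto
      moreover have "card (?U - {(p, \<rho>) \<in> P \<times> T. \<iota> \<notin> Y \<rho> (msg X p \<rho>)}) =
          card ?U - card {(p, \<rho>) \<in> P \<times> T. \<iota> \<notin> Y \<rho> (msg X p \<rho>)}"
        using finU by (intro card_Diff_subset) (auto intro: finite_subset[of _ ?U])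
      moreover have "card {(p, \<rho>) \<in> P \<times> T. \<iota> \<notin> Y \<rho> (msg X p \<rho>)} \<le> card ?U"
        using finU by (intro card_mono) auto
      ultimately have "real (card {z \<in> ?U. \<iota> \<in> ?Y z}) =
          ?N - real (card {(p, \<rho>) \<in> P \<times> T. \<iota> \<notin> Y \<rho> (msg X p \<rho>)})"
        using cU by (simp add: of_nat_diff)
      with missed[OF X that] show ?thesis by linarith
    qed
    have "real m * (?N / 3) = (\<Sum>\<iota>\<in>X. ?N / 3)" using Xm by simp
    also have "\<dots> \<le> (\<Sum>\<iota>\<in>X. real (card {z \<in> ?U. \<iota> \<in> ?Y z}))"
      by (intro sum_mono hit)
    also have "\<dots> = (\<Sum>\<iota>\<in>X. \<Sum>z\<in>?U. of_bool (\<iota> \<in> ?Y z))"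
      using finU by (simp add: Int_def)
    also have "\<dots> = (\<Sum>z\<in>?U. \<Sum>\<iota>\<in>X. of_bool (\<iota> \<in> ?Y z))" by (rule sum.swap)
    also have "\<dots> = (\<Sum>z\<in>?U. real (card (?Y z \<inter> X)))"
      using Xm by (simp add: Int_def conj_commute)
    also have "\<dots> \<le> (\<Sum>z\<in>?U. real m * of_bool (z \<in> U2) + real m / 6)"
    proof (rule sum_mono)
      fix z assume z: "z \<in> ?U"
      have "card (?Y z \<inter> X) \<le> m" using card_mono[of X "?Y z \<inter> X"] Xm by auto
      with z show "real (card (?Y z \<inter> X)) \<le> real m * of_bool (z \<in> U2) + real m / 6"
        by (cases "z \<in> U2") (auto simp: U2_def)
    qed
    also have "\<dots> = real m * real (card (?U \<inter> U2)) + ?N * (real m / 6)"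
      using finU cU by (simp add: sum.distrib flip: sum_distrib_left)
    also have "?U \<inter> U2 = U2" by (auto simp: U2_def)
    finally have "real m * (?N / 3) \<le> real m * (real (card U2) + ?N / 6)"
      by (simp add: algebra_simps)
    then have U2: "?N / 6 \<le> real (card U2)" using m by (simp add: mult_le_cancel_left)
    have "U2 \<subseteq> U1 \<union> G"
    proof
      fix z assume z: "z \<in> U2"
      have "card (?Y z \<inter> X) \<le> card (?Y z)"
        using finY by (intro card_mono) (auto split: prod.splits)
      then show "z \<in> U1 \<union> G"
        using z by (auto simp: U2_def U1_def G_def good_def)
    qed
    then have "card U2 \<le> card U1 + card G"
      using finU by (intro order_trans[OF card_mono card_Un_le]) (auto simp: U1_def G_def intro: finite_subset[of _ ?U])
    with U1 U2 show ?thesis unfolding G_def by linarith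
  qed

  let ?g = "(real n / real m) powr (real m / 6)"
  \<comment> \<open>Averaging fixes one pair of random strings that is good for 1/15 of all sets
    \<open>X\<close>. From here on the message is the only thing that carries information about
    \<open>X\<close>.\<close>
  obtain p \<rho> where p: "p \<in> P" and \<rho>: "\<rho> \<in> T"
    and many: "real (n choose m) / 15 \<le> real (card {X \<in> \<Omega> n m. good X p \<rho>})"
  proof -
    have "\<exists>z\<in>P \<times> T. real (n choose m) / 15 \<le> real (card {X \<in> \<Omega> n m. case z of (p, \<rho>) \<Rightarrow> good X p \<rho>})"
    proof (rule ccontr)
      assume "\<not> ?thesis"
      then have "(\<Sum>z\<in>P \<times> T. real (card {X \<in> \<Omega> n m. case z of (p, \<rho>) \<Rightarrow> good X p \<rho>}))
          < (\<Sum>z\<in>P \<times> T. real (n choose m) / 15)"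
        using P finT T0 P0 by (intro sum_strict_mono) (auto simp: not_le card_gt_0_iff)
      also have "\<dots> = (\<Sum>X\<in>\<Omega> n m. real (card P) * real (card T) / 15)"
        using \<Omega> by (simp add: card_cartesian_product)
      also have "\<dots> \<le> (\<Sum>X\<in>\<Omega> n m. real (card {(p, \<rho>) \<in> P \<times> T. good X p \<rho>}))"
        by (intro sum_mono good_many)
      also have "\<dots> = (\<Sum>X\<in>\<Omega> n m. \<Sum>z\<in>P \<times> T. of_bool (case z of (p, \<rho>) \<Rightarrow> good X p \<rho>))"
        using P finT by (intro sum.cong refl) (simp add: Int_def split_beta' mem_Times_iff)
      also have "\<dots> = (\<Sum>z\<in>P \<times> T. \<Sum>X\<in>\<Omega> n m. of_bool (case z of (p, \<rho>) \<Rightarrow> good X p \<rho>))"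
        by (rule sum.swap)
      also have "\<dots> = (\<Sum>z\<in>P \<times> T. real (card {X \<in> \<Omega> n m. case z of (p, \<rho>) \<Rightarrow> good X p \<rho>}))"
        using \<Omega> by (intro sum.cong refl) (simp add: Int_def)
      finally show False by simp
    qed
    then show ?thesis using that by auto
  qed
  let ?S = "{..<K} \<rightarrow>\<^sub>E W"
  have finS: "finite ?S" using W by (simp add: finite_PiE)
  \<comment> \<open>The sets that a decoder reading \<open>s\<close> cannot rule out. Each such
    class is at most a fraction 1/\<open>?g\<close> of all m-sets, yet the |W|^K classes together
    cover a fraction 1/15.\<close>
  define D where "D s = {X \<in> \<Omega> n m. Y \<rho> s \<subseteq> X \<and> real m / 6 \<le> real (card (Y \<rho> s))}" for s
  have D: "real (card (D s)) * ?g \<le> real (n choose m)" for s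
  proof (cases "real m / 6 \<le> real (card (Y \<rho> s))")
    case True
    then have "D s = {X. X \<subseteq> {..<n} \<and> card X = m \<and> Y \<rho> s \<subseteq> X}" by (auto simp: D_def \<Omega>_def)
    moreover have "Y \<rho> s \<subseteq> {..<n}" by (auto simp: Y_def)
    ultimately show ?thesis using card_supersets_le[OF _ m True] by simp
  next
    case False
    then have "D s = {}" by (auto simp: D_def)
    then show ?thesis by simp
  qed
  have "{X \<in> \<Omega> n m. good X p \<rho>} \<subseteq> (\<Union>s\<in>?S. D s)"
  proof
    fix X assume X: "X \<in> {X \<in> \<Omega> n m. good X p \<rho>}"
    then have "msg X p \<rho> \<in> ?S" using st[of X p] p \<rho> by (auto simp: msg_def T_def PiE_iff)
    moreover have "X \<in> D (msg X p \<rho>)" using X by (auto simp: D_def good_def)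
    ultimately show "X \<in> (\<Union>s\<in>?S. D s)" by blast
  qed
  then have "card {X \<in> \<Omega> n m. good X p \<rho>} \<le> card (\<Union>s\<in>?S. D s)"
    using finS \<Omega> by (intro card_mono) (auto simp: D_def)
  also have "\<dots> \<le> (\<Sum>s\<in>?S. card (D s))" by (intro card_UN_le finS)
  finally have "real (card {X \<in> \<Omega> n m. good X p \<rho>}) * ?g \<le> real (\<Sum>s\<in>?S. card (D s)) * ?g"
    by (intro mult_right_mono of_nat_mono) auto
  also have "\<dots> = (\<Sum>s\<in>?S. real (card (D s)) * ?g)" by (simp add: sum_distrib_right)
  also have "\<dots> \<le> (\<Sum>s\<in>?S. real (n choose m))" by (intro sum_mono D)
  also have "\<dots> = real (card W) ^ K * real (n choose m)" by (simp add: card_PiE)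
  finally have "real (n choose m) / 15 * ?g \<le> real (card W) ^ K * real (n choose m)"
    using many mult_right_mono[OF many, of ?g] by simp
  then have "real (n choose m) * ?g \<le> real (n choose m) * (15 * real (card W) ^ K)"
    by (simp add: mult_ac)
  moreover have "0 < real (n choose m)" using m by simp
  ultimately show ?thesis unfolding K_def by (simp only: mult_le_cancel_left_pos)
qed

section \<open>The lower bound\<close>

definition inserts :: "nat set \<Rightarrow> pq_elem list" where
  "inserts X = map (\<lambda>i. Update i 1) (sorted_list_of_set X)"

lemma freq_inserts:
  assumes "finite X"
  shows "freq (inserts X @ [Query \<iota>]) i = of_bool (i \<in> X)"
proof -
  have "freq (inserts X @ [Query \<iota>]) i = (\<Sum>j\<leftarrow>sorted_list_of_set X. if j = i then 1 else 0)"
    by (simp add: freq_append freq_Cons inserts_def freq_def comp_def)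
  also have "\<dots> = (\<Sum>j\<in>X. if j = i then 1 else 0)"
    using assms by (simp add: sum_list_distinct_conv_sum_set)
  finally show ?thesis using assms by simp
qed

lemma card_completeness_le:
  assumes "completeness_error_le S D F (1/3)" "x \<in> D"
  shows "3 * card {(p, r) \<in> bitstrings (prover_coins S) \<times> bitstrings (verifier_coins S).
           run S r x (honest S x p) \<noteq> Some (F x)}
         \<le> card (bitstrings (prover_coins S)) * card (bitstrings (verifier_coins S))"
proof -
  let ?Z = "{(p, r). run S r x (honest S x p) \<noteq> Some (F x)}"
  let ?U = "bitstrings (prover_coins S) \<times> bitstrings (verifier_coins S)"
  have "real (card {z \<in> ?U. z \<in> ?Z}) / (2 ^ prover_coins S * 2 ^ verifier_coins S) \<le> 1/3"
    using assms unfolding completeness_error_le_def prob_coins_pair by blast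
  then have "real (3 * card {z \<in> ?U. z \<in> ?Z}) \<le> real (2 ^ prover_coins S * 2 ^ verifier_coins S)"
    by (simp add: field_simps)
  then have "3 * card {z \<in> ?U. z \<in> ?Z} \<le> 2 ^ prover_coins S * 2 ^ verifier_coins S"
    by (simp only: of_nat_le_iff)
  moreover have "{z \<in> ?U. z \<in> ?Z} = {(p, r) \<in> ?U. run S r x (honest S x p) \<noteq> Some (F x)}"
    by auto
  ultimately show ?thesis by simp
qed

lemma card_soundness_le:
  assumes "soundness_error_le S D F (1/3)" "x \<in> D" "length as = length x"
  shows "3 * card {r \<in> bitstrings (verifier_coins S). run S r x as \<notin> {Some (F x), None}}
         \<le> card (bitstrings (verifier_coins S))"
proof -
  have "real (card {r \<in> bitstrings (verifier_coins S). r \<in> {r. run S r x as \<notin> {Some (F x), None}}}) / 2 ^ verifier_coins S \<le> 1/3"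
    using assms unfolding soundness_error_le_def prob_coins by blast
  then have "real (3 * card {r \<in> bitstrings (verifier_coins S). run S r x as \<notin> {Some (F x), None}}) \<le> real (2 ^ verifier_coins S)"
    by (simp add: field_simps)
  then show ?thesis by (simp only: of_nat_le_iff card_bitstrings)
qed

lemma foldl_step_bitstrings:
  assumes "respects_space S" "r \<in> bitstrings (verifier_coins S)" "s \<in> bitstrings (memory S)"
  shows "foldl (step S r) s ts \<in> bitstrings (memory S)"
  using assms(3) by (induction ts arbitrary: s) (use assms(1,2) in \<open>auto simp: respects_space_def\<close>)

text \<open>The case m = n, where log (n/m) = 0, is settled separately. With m < n there are m-sets
  containing a given item and m-sets avoiding it, and log n is at least 1.\<close>

locale sparse_pq_scheme =
  fixes S :: "(pq_elem, int) scheme" and k n m :: nat and ca cv :: real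
  assumes m: "1 \<le> m" "m < n" and ca: "log 2 (real n) \<le> ca"
    and S: "online_scheme S {x \<in> pq_inputs n (n ^ k). sparsity x = m} point_query ca cv"
begin

abbreviation "inputs \<equiv> {x \<in> pq_inputs n (n ^ k). sparsity x = m}"
abbreviation "stream X \<iota> \<equiv> inserts X @ [Query \<iota>]"
abbreviation "prover_strings \<equiv> bitstrings (prover_coins S)"
abbreviation "verifier_strings \<equiv> bitstrings (verifier_coins S)"

lemma stream_inputs:
  assumes "X \<subseteq> {..<n}" "card X = m" "\<iota> < n"
  shows "stream X \<iota> \<in> inputs"
proof -
  have fin: "finite X" using assms finite_subset by blast
  have "stream X \<iota> = map (\<lambda>(i, \<delta>). Update i \<delta>) (map (\<lambda>i. (i, 1)) (sorted_list_of_set X)) @ [Query \<iota>]"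
    by (simp add: inserts_def)
  moreover have "fst ` set (map (\<lambda>i. (i, 1)) (sorted_list_of_set X)) \<subseteq> {..<n}"
    using assms fin by auto
  moreover have "\<bar>freq (stream X \<iota>) i\<bar> \<le> int (n ^ k)" for i
    using m fin by (simp add: freq_inserts)
  moreover have "sparsity (stream X \<iota>) = m"
    using assms fin by (simp add: sparsity_def freq_inserts)
  ultimately show ?thesis using assms(3) unfolding pq_inputs_def by blast
qed

lemma point_query_stream:
  assumes "X \<subseteq> {..<n}"
  shows "point_query (stream X \<iota>) = of_bool (\<iota> \<in> X)"
  using freq_inserts[of X] assms finite_subset[of X] by (simp add: point_query_def)

text \<open>With an empty memory the answer is a function of the coins alone, yet the query 0 needs
  the answer 1 on \<open>{..<m}\<close> and 0 on \<open>{1..m}\<close>. The two error events cover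
  everything, against 1/3 + 1/3 < 1. The bound serves to absorb an additive constant into the
  product of annotation length and space.\<close>

lemma memory_pos: "0 < memory S"
proof (rule ccontr)
  assume "\<not> 0 < memory S"
  then have mem: "bitstrings (memory S) = {[]}" by (auto simp: bitstrings_def)
  let ?U = "prover_strings \<times> verifier_strings"
  have sp: "respects_space S" and co: "completeness_error_le S inputs point_query (1/3)"
    using S by (auto simp: online_scheme_def)
  have run: "run S r x as = answer S r []" if "r \<in> verifier_strings" for r x as
    using foldl_step_bitstrings[OF sp that, of "start S r"] sp that mem
    by (auto simp: run_def respects_space_def)
  have *: "3 * card {(p, r) \<in> ?U. answer S r [] \<noteq> Some (of_bool (0 \<in> X))} \<le> card ?U"
    if X: "X \<subseteq> {..<n}" "card X = m" for X
  proof -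
    have "stream X 0 \<in> inputs" using stream_inputs X m by simp
    from card_completeness_le[OF co this] point_query_stream[OF X(1), of 0]
    show ?thesis using run by (simp add: card_cartesian_product cong: conj_cong)
  qed
  have "{..<m} \<subseteq> {..<n}" "{1..m} \<subseteq> {..<n}" "0 \<in> {..<m}" using m by auto
  with *[of "{..<m}"] *[of "{1..m}"]
  have "3 * card {(p, r) \<in> ?U. answer S r [] \<noteq> Some 1} \<le> card ?U"
    "3 * card {(p, r) \<in> ?U. answer S r [] \<noteq> Some 0} \<le> card ?U"
    by simp_all
  moreover have "card ?U \<le> card ({(p, r) \<in> ?U. answer S r [] \<noteq> Some 1} \<union> {(p, r) \<in> ?U. answer S r [] \<noteq> Some 0})"
    by (rule card_mono) (auto intro: finite_subset[of _ ?U])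
  moreover have "\<dots> \<le> card {(p, r) \<in> ?U. answer S r [] \<noteq> Some 1} + card {(p, r) \<in> ?U. answer S r [] \<noteq> Some 0}"
    by (rule card_Un_le)
  moreover have "0 < card ?U" by (simp add: card_cartesian_product)
  ultimately show False by linarith
qed

text \<open>The query 0 is a placeholder that makes the stream admissible; by
  \<open>honest_stream\<close> any other query gives the same annotations.\<close>

definition update_annots :: "nat set \<Rightarrow> bool list \<Rightarrow> bool list list" where
  "update_annots X p = map (annotation S (stream X 0) p) [0..<m]"

definition state :: "nat set \<Rightarrow> bool list \<Rightarrow> bool list \<Rightarrow> bool list" where
  "state X p r = foldl (step S r) (start S r) (interleave (inserts X) (update_annots X p))"

definition query_annot :: "nat set \<Rightarrow> bool list \<Rightarrow> nat \<Rightarrow> bool list" where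
  "query_annot X p \<iota> = annotation S (stream X \<iota>) p m"

definition accepts :: "bool list \<Rightarrow> bool list \<Rightarrow> nat \<Rightarrow> bool list \<Rightarrow> bool" where
  "accepts r s \<iota> \<beta> \<longleftrightarrow> answer S r (foldl (step S r) s (Elem (Query \<iota>) # map Annot \<beta>)) = Some 1"

lemma length_inserts: "X \<subseteq> {..<n} \<Longrightarrow> card X = m \<Longrightarrow> length (inserts X) = m"
  by (simp add: inserts_def)

lemma accepts_iff_run:
  assumes "X \<subseteq> {..<n}" "card X = m"
  shows "accepts r (state X p r) \<iota> \<beta> \<longleftrightarrow> run S r (stream X \<iota>) (update_annots X p @ [\<beta>]) = Some 1"
  using length_inserts[OF assms]
  by (simp add: accepts_def state_def run_def interleave_append update_annots_def)

text \<open>Onlineness at work: two streams for \<open>X\<close> agree on their first m elements, so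
  the annotations up to there, and with them the memory contents, do not depend on the
  query.\<close>

lemma honest_stream:
  assumes "X \<subseteq> {..<n}" "card X = m" "\<iota> < n" "p \<in> prover_strings"
  shows "honest S (stream X \<iota>) p = update_annots X p @ [query_annot X p \<iota>]"
proof -
  have len: "length (inserts X) = m" by (rule length_inserts[OF assms(1,2)])
  have "annotation S (stream X \<iota>) p i = annotation S (stream X 0) p i" if "i < m" for i
  proof -
    have "online S inputs" using S by (simp add: online_scheme_def)
    moreover have "stream X \<iota> \<in> inputs" "stream X 0 \<in> inputs"
      using stream_inputs assms m by simp_all
    moreover have "take (Suc i) (stream X \<iota>) = take (Suc i) (stream X 0)"
      using that len by simp
    ultimately show ?thesis
      using that len assms(4) unfolding online_def by (metis (no_types, lifting) length_append trans_less_add1)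
  qed
  then show ?thesis using len by (simp add: honest_def update_annots_def query_annot_def)
qed

lemma lower_bound: "ca * cv \<ge> 1 / 1056 * (real m * log 2 (real n / real m))"
proof -
  define A where "A = nat \<lceil>ca\<rceil>"
  define B where "B = {\<beta> :: bool list. length \<beta> \<le> A}"
  have "log 2 2 \<le> log 2 (real n)" using m by (intro log_mono) auto
  then have ca1: "1 \<le> ca" using ca by simp
  then have A: "1 \<le> A" "ca \<le> real A" "real A \<le> 2 * ca" unfolding A_def by linarith+
  have B': "B = {\<beta>. set \<beta> \<subseteq> UNIV \<and> length \<beta> \<le> A}" by (simp add: B_def)
  have finB: "finite B" unfolding B' by (rule finite_lists_length_le) simp
  have "card B = (\<Sum>i\<le>A. 2 ^ i)" unfolding B' by (subst card_lists_length_le) simp_all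
  then have "card B \<le> 2 * 2 ^ A"
    by (simp add: sum_power2 flip: lessThan_Suc_atMost atLeast0LessThan)
  from of_nat_mono[OF this, where 'a = real] have cardB: "real (card B) \<le> 2 * 2 ^ A"
    by simp
  have "real n = 2 powr log 2 (real n)" using m by simp
  also have "\<dots> \<le> 2 powr real A" using ca A by (intro powr_mono) auto
  finally have nA: "real n \<le> 2 ^ A" by (simp add: powr_realpow)
  have sp: "respects_space S" and co: "completeness_error_le S inputs point_query (1/3)"
    and so: "soundness_error_le S inputs point_query (1/3)"
    and al: "annotation_length_le S inputs ca" and w: "real (memory S) \<le> cv"
    using S by (auto simp: online_scheme_def)
  have "(real n / real m) powr (real m / 6) \<le> 15 * real (card (bitstrings (memory S))) ^ (2 * (42 * A))"
  proof (rule decoding_bound[where P = prover_strings and R = verifier_strings and B = B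
        and st = state and acc = accepts and b = query_annot])
    show "0 < m" "m \<le> n" "0 < 42 * A" using m A by auto
    have "real n * real (card B) * (8 / 9) ^ (42 * A) \<le> 2 ^ A * (2 * 2 ^ A) * (1 / 128) ^ A"
      unfolding power_mult using nA cardB
      by (intro mult_mono power_mono) (auto simp: power_divide)
    also have "\<dots> = 2 * (1 / 32) ^ A"
      by (simp add: power_divide field_simps flip: power_mult_distrib)
    also have "\<dots> \<le> 2 * (1 / 32) ^ 1" using A by (intro mult_left_mono power_decreasing) auto
    finally show "real n * real (card B) * (8 / 9) ^ (42 * A) \<le> 1 / 10" by simp
  next
    fix X p r assume "X \<in> {X. X \<subseteq> {..<n} \<and> card X = m}" "p \<in> prover_strings" "r \<in> verifier_strings"
    then show "state X p r \<in> bitstrings (memory S)"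
      unfolding state_def using sp by (intro foldl_step_bitstrings) (auto simp: respects_space_def)
  next
    fix X p \<iota> \<beta> assume X: "X \<in> {X. X \<subseteq> {..<n} \<and> card X = m}" and "p \<in> prover_strings" and \<iota>: "\<iota> < n" "\<iota> \<notin> X"
    let ?as = "update_annots X p @ [\<beta>]"
    have D: "stream X \<iota> \<in> inputs" using stream_inputs X \<iota> by simp
    have "length ?as = length (stream X \<iota>)" using X length_inserts by (simp add: update_annots_def)
    note card_soundness_le[OF so D this]
    moreover have "{r \<in> verifier_strings. accepts r (state X p r) \<iota> \<beta>}
        \<subseteq> {r \<in> verifier_strings. run S r (stream X \<iota>) ?as \<notin> {Some (point_query (stream X \<iota>)), None}}"
      using X \<iota> by (auto simp: accepts_iff_run point_query_stream)
    then have "card {r \<in> verifier_strings. accepts r (state X p r) \<iota> \<beta>}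
        \<le> card {r \<in> verifier_strings. run S r (stream X \<iota>) ?as \<notin> {Some (point_query (stream X \<iota>)), None}}"
      by (intro card_mono) auto
    ultimately show "3 * card {r \<in> verifier_strings. accepts r (state X p r) \<iota> \<beta>} \<le> card verifier_strings"
      by linarith
  next
    fix X p \<iota> assume X: "X \<in> {X. X \<subseteq> {..<n} \<and> card X = m}" and p: "p \<in> prover_strings" and \<iota>: "\<iota> \<in> X"
    have D: "stream X \<iota> \<in> inputs" using stream_inputs X \<iota> by auto
    have "length (stream X \<iota>) = Suc m" using X length_inserts by simp
    with al D p have "real (\<Sum>i<Suc m. length (annotation S (stream X \<iota>) p i)) \<le> ca"
      unfolding annotation_length_le_def by metis
    moreover have "0 \<le> (\<Sum>i<m. real (length (annotation S (stream X \<iota>) p i)))"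
      by (intro sum_nonneg) simp
    ultimately have "real (length (query_annot X p \<iota>)) \<le> real A"
      using A(2) unfolding query_annot_def by simp
    then show "query_annot X p \<iota> \<in> B" by (simp add: B_def)
  next
    fix X \<iota> assume X: "X \<in> {X. X \<subseteq> {..<n} \<and> card X = m}" and \<iota>: "\<iota> \<in> X"
    have \<iota>n: "\<iota> < n" and D: "stream X \<iota> \<in> inputs" using stream_inputs X \<iota> by auto
    have "{(p, r) \<in> prover_strings \<times> verifier_strings. \<not> accepts r (state X p r) \<iota> (query_annot X p \<iota>)}
      = {(p, r) \<in> prover_strings \<times> verifier_strings.
          run S r (stream X \<iota>) (honest S (stream X \<iota>) p) \<noteq> Some (point_query (stream X \<iota>))}"
      using X \<iota> \<iota>n by (auto simp: accepts_iff_run point_query_stream honest_stream)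
    with card_completeness_le[OF co D]
    show "3 * card {(p, r) \<in> prover_strings \<times> verifier_strings. \<not> accepts r (state X p r) \<iota> (query_annot X p \<iota>)}
        \<le> card prover_strings * card verifier_strings" by simp
  qed (use finB in auto)
  then have "log 2 ((real n / real m) powr (real m / 6)) \<le> log 2 (15 * (2 ^ memory S) ^ (84 * A))"
    using m by (intro log_mono) auto
  also have "\<dots> = log 2 15 + real (84 * A * memory S)"
    by (simp add: log_mult log_nat_power mult_ac flip: power_mult)
  also have "log 2 15 \<le> log 2 (2 ^ 4)" by (intro log_mono) auto
  also have "log 2 (2 ^ 4 :: real) = 4" by (subst log_nat_power) auto
  also have "log 2 ((real n / real m) powr (real m / 6)) = real m / 6 * log 2 (real n / real m)"
    using m by (simp add: log_powr)
  finally have 1: "real m * log 2 (real n / real m) \<le> 24 + 504 * (real A * real (memory S))"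
    by simp
  \<comment> \<open>The 24 = 6 * 4 comes from log 15 \<le> 4. As the product is at least 1, it goes
    into 504 + 24 = 528, and rounding \<open>ca\<close> up to \<open>A \<le> 2 * ca\<close> doubles
    this to 1056.\<close>
  have "1 * 1 \<le> real A * real (memory S)" using A memory_pos by (intro mult_mono) auto
  with 1 have 2: "real m * log 2 (real n / real m) \<le> 528 * (real A * real (memory S))" by linarith
  have "real A * real (memory S) \<le> (2 * ca) * cv" using A w ca1 by (intro mult_mono) auto
  with 2 show ?thesis by simp
qed

end

lemma pq_lower_bound:
  assumes "1 \<le> m" "m \<le> n" "log 2 (real n) \<le> ca"
    "online_scheme S {x \<in> pq_inputs n (n ^ k). sparsity x = m} point_query ca cv"
  shows "ca * cv \<ge> 1 / 1056 * (real m * log 2 (real n / real m))"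
proof (cases "m = n")
  case True
  have "0 \<le> log 2 (real n)" using assms by simp
  then have "0 \<le> ca" using assms by linarith
  moreover have "0 \<le> cv" using assms(4) unfolding online_scheme_def
    by (meson of_nat_0_le_iff order_trans)
  ultimately show ?thesis using assms True by simp
next
  case False
  then interpret sparse_pq_scheme S k n m ca cv
    using assms by unfold_locales auto
  show ?thesis by (rule lower_bound)
qed

section \<open>Compressed states and hashing\<close>

text \<open>If the compressed value determines the next compressed value and the output, it can
  stand for the state itself, with any representative used for computing. A verifier can thus be
  described with unbounded integers, and its memory is settled by counting compressed
  values.\<close>

lemma scheme_of_compression:
  fixes next_state :: "'s \<Rightarrow> 'x token \<Rightarrow> 's" and compress :: "'r \<Rightarrow> 's \<Rightarrow> 'c"
    and out :: "'r \<Rightarrow> 's \<Rightarrow> 'o option"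
  assumes init: "I s0" and inv: "\<And>s t. I s \<Longrightarrow> I (next_state s t)"
    and cong: "\<And>r s s' t. I s \<Longrightarrow> I s' \<Longrightarrow> compress r s = compress r s' \<Longrightarrow>
        compress r (next_state s t) = compress r (next_state s' t)"
    and out: "\<And>r s s'. I s \<Longrightarrow> I s' \<Longrightarrow> compress r s = compress r s' \<Longrightarrow> out r s = out r s'"
    and A: "finite A" "card A \<le> 2 ^ w" "\<And>r s. I s \<Longrightarrow> compress r s \<in> A"
  obtains start :: "'r \<Rightarrow> bool list" and step :: "'r \<Rightarrow> bool list \<Rightarrow> 'x token \<Rightarrow> bool list"
    and answer :: "'r \<Rightarrow> bool list \<Rightarrow> 'o option"
  where "\<And>r. start r \<in> bitstrings w"
    "\<And>r s t. s \<in> bitstrings w \<Longrightarrow> step r s t \<in> bitstrings w"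
    "\<And>r ts. answer r (foldl (step r) (start r) ts) = out r (foldl next_state s0 ts)"
proof -
  have "card A \<le> card (bitstrings w)" using A by simp
  then obtain f where f: "f ` A \<subseteq> bitstrings w" "inj_on f A"
    using card_le_inj[OF A(1) finite_bitstrings] by blast
  define enc where "enc r s = f (compress r s)" for r s
  define rep where "rep r b = (SOME s. I s \<and> enc r s = b)" for r b
  \<comment> \<open>Strings that encode no state are mapped to themselves, since the space condition
    concerns every string of length \<open>w\<close>, reachable or not.\<close>
  define step where "step r b t = (if \<exists>s. I s \<and> enc r s = b then enc r (next_state (rep r b) t) else b)" for r b t
  define answer where "answer r b = out r (rep r b)" for r b
  have enc: "enc r s \<in> bitstrings w" if "I s" for r s
    using f(1) A(3)[OF that] by (auto simp: enc_def)
  have rep: "I (rep r (enc r s))" "compress r (rep r (enc r s)) = compress r s" if "I s" for r s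
  proof -
    have *: "I (rep r (enc r s)) \<and> enc r (rep r (enc r s)) = enc r s"
      unfolding rep_def by (rule someI_ex) (use that in blast)
    then show "I (rep r (enc r s))" by simp
    show "compress r (rep r (enc r s)) = compress r s"
      using * f(2) A(3)[OF that, of r] A(3)[of "rep r (enc r s)" r] unfolding enc_def by (auto dest: inj_onD)
  qed
  have step_enc: "step r (enc r s) t = enc r (next_state s t)" if "I s" for r s t
    unfolding step_def using that cong[OF rep(1)[OF that] that rep(2)[OF that]]
    by (auto simp: enc_def)
  have I: "I (foldl next_state s0 ts)" for ts
    using init by (induction ts rule: rev_induct) (auto intro: inv)
  have fold: "foldl (step r) (enc r s0) ts = enc r (foldl next_state s0 ts)" for r ts
    by (induction ts rule: rev_induct) (simp_all add: step_enc I)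
  show thesis
  proof (rule that)
    show "enc r s0 \<in> bitstrings w" for r by (rule enc[OF init])
    show "step r s t \<in> bitstrings w" if "s \<in> bitstrings w" for r s t
      using that enc inv rep unfolding step_def by (metis (mono_tags, lifting))
    show "answer r (foldl (step r) (enc r s0) ts) = out r (foldl next_state s0 ts)" for r ts
      unfolding fold answer_def by (intro out rep I)
  qed
qed

lemma card_bounded_lists_le:
  fixes N :: nat
  assumes "finite U" "card U \<le> N" "2 \<le> N"
  shows "card {xs. set xs \<subseteq> U \<and> length xs \<le> l} \<le> N ^ Suc l"
proof -
  have "card {xs. set xs \<subseteq> U \<and> length xs \<le> l} = (\<Sum>i\<le>l. card U ^ i)"
    using assms by (intro card_lists_length_le)
  also have "\<dots> \<le> (\<Sum>i\<le>l. N ^ i)"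
    using assms by (intro sum_mono power_mono) auto
  also have "\<dots> \<le> N ^ Suc l"
  proof (induction l)
    case (Suc l)
    have "(\<Sum>i\<le>Suc l. N ^ i) \<le> 2 * N ^ Suc l" using Suc by simp
    also have "\<dots> \<le> N * N ^ Suc l" using assms by (intro mult_right_mono) auto
    finally show ?case by simp
  qed (use assms in simp)
  finally show ?thesis .
qed

text \<open>The hash value is the position of \<open>a * i mod Q\<close> among \<open>t\<close> equal subintervals of \<open>{0..<Q}\<close>.\<close>

definition bucket :: "nat \<Rightarrow> nat \<Rightarrow> nat \<Rightarrow> nat \<Rightarrow> nat" where
  "bucket Q t a i = (a * i) mod Q * t div Q"

lemma bucket_less: "0 < Q \<Longrightarrow> 0 < t \<Longrightarrow> bucket Q t a i < t"
  unfolding bucket_def by (simp add: less_mult_imp_div_less mult.commute)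

text \<open>The products \<open>a * d\<close> are spaced \<open>d\<close> apart and must lie in a
  window of length 2Q/t around \<open>c\<close>, which leaves room for at most 2Q/(td) + 1 of them.
  The bound is multiplied out by \<open>t * d\<close>.\<close>

lemma card_multiples_near_le:
  fixes c :: int
  assumes "0 < d" "0 < t"
  shows "card {a::nat. \<bar>int a * int d - c\<bar> * int t < int Q} * (t * d) \<le> 2 * Q + t * d"
proof -
  let ?S = "{a::nat. \<bar>int a * int d - c\<bar> * int t < int Q}"
  show ?thesis
  proof (cases "?S = {}")
    case False
    define lo where "lo = (LEAST a. a \<in> ?S)"
    have lo: "lo \<in> ?S" unfolding lo_def using False by (metis (mono_tags, lifting) LeastI ex_in_conv)
    have le: "lo \<le> a" if "a \<in> ?S" for a unfolding lo_def using that by (rule Least_le)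
    have gap: "(a - lo) * (t * d) \<le> 2 * Q" if "a \<in> ?S" for a
    proof -
      have "int (a - lo) * int d \<le> \<bar>int a * int d - c\<bar> + \<bar>int lo * int d - c\<bar>"
        using le[OF that] by (simp add: of_nat_diff left_diff_distrib)
      then have "int (a - lo) * int d * int t \<le> (\<bar>int a * int d - c\<bar> + \<bar>int lo * int d - c\<bar>) * int t"
        by (intro mult_right_mono) auto
      also have "\<dots> \<le> 2 * int Q" using that lo by (simp add: algebra_simps)
      finally show ?thesis by (simp add: mult_ac flip: of_nat_mult of_nat_le_iff)
    qed
    have "?S \<subseteq> {lo..lo + 2 * Q div (t * d)}"
    proof
      fix a assume a: "a \<in> ?S"
      have "a - lo \<le> 2 * Q div (t * d)"
        using gap[OF a] assms by (simp add: less_eq_div_iff_mult_less_eq)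
      with le[OF a] show "a \<in> {lo..lo + 2 * Q div (t * d)}" by simp
    qed
    from card_mono[OF _ this] have "card ?S \<le> Suc (2 * Q div (t * d))" by simp
    then have "card ?S * (t * d) \<le> Suc (2 * Q div (t * d)) * (t * d)" by (rule mult_right_mono) simp
    also have "\<dots> \<le> 2 * Q + t * d" by simp
    finally show ?thesis .
  next
    case True
    show ?thesis unfolding True by simp
  qed
qed

text \<open>If \<open>i\<close> and \<open>i + d\<close> collide under \<open>a\<close>, then \<open>a * d\<close> lies within \<open>Q / t\<close> of one of the multiples
  \<open>0, Q, \<dots>, d * Q\<close>.\<close>

lemma card_collisions_le_aux:
  assumes d: "0 < d" "i + d < n" and t: "0 < t" "t \<le> n" and Q: "n * n \<le> Q"
  shows "card {a. a < Q \<and> bucket Q t a i = bucket Q t a (i + d)} * t \<le> 5 * Q"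
proof -
  let ?C = "{a. a < Q \<and> bucket Q t a i = bucket Q t a (i + d)}"
  let ?N = "\<lambda>j. {a::nat. \<bar>int a * int d - int (j * Q)\<bar> * int t < int Q}"
  have "0 < n" using d by simp
  then have "0 < n * n" by simp
  then have Q0: "0 < Q" using Q by linarith
  have "?C \<subseteq> (\<Union>j\<in>{..d}. {a \<in> ?N j. a < Q})"
  proof
    fix a assume a: "a \<in> ?C"
    define u v where "u = a * (i + d) mod Q" and "v = a * i mod Q"
    define x y where "x = a * (i + d) div Q" and "y = a * i div Q"
    have "u * t div Q = v * t div Q" using a by (simp add: bucket_def u_def v_def)
    \<comment> \<open>\<open>c\<close> is \<open>Q\<close> times the common bucket number, so
      \<open>u * t\<close> and \<open>v * t\<close> lie in the same interval of length
      \<open>Q\<close>.\<close>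
    then obtain c where "u * t = c + u * t mod Q" "v * t = c + v * t mod Q"
      by (metis mult_div_mod_eq)
    moreover have "u * t mod Q < Q" "v * t mod Q < Q" using Q0 by auto
    ultimately have "u * t < v * t + Q" "v * t < u * t + Q" by (metis add.commute add_strict_left_mono add_less_le_mono le_add1 trans_less_add1 add.assoc)+
    then have "\<bar>int (u * t) - int (v * t)\<bar> < int Q" by linarith
    then have uv: "\<bar>int u - int v\<bar> * int t < int Q"
      by (simp add: abs_mult flip: left_diff_distrib)
    have yx: "y \<le> x" unfolding x_def y_def by (intro div_le_mono mult_left_mono) auto
    have "int (a * (i + d)) = int Q * int x + int u" "int (a * i) = int Q * int y + int v"
      by (simp_all add: u_def v_def x_def y_def flip: of_nat_mult of_nat_add)
    then have ad: "int a * int d - int ((x - y) * Q) = int u - int v"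
      using yx by (simp add: of_nat_diff algebra_simps)
    \<comment> \<open>The index of the multiple stays within 0 to \<open>d\<close> because
      \<open>a\<close> and \<open>v\<close> are below \<open>Q\<close>; this leaves
      \<open>d + 1\<close> windows.\<close>
    have "x - y \<le> d"
    proof -
      have "v < Q" using Q0 by (simp add: v_def)
      then have "- int Q < int u - int v" by linarith
      then have "int ((x - y) * Q) < int a * int d + int Q" using ad by linarith
      also have "int a * int d \<le> int Q * int d" using a by (intro mult_right_mono) auto
      finally have "int ((x - y) * Q) < int (Suc d * Q)" by (simp add: algebra_simps)
      then have "x - y < Suc d" using Q0 by (simp only: of_nat_less_iff mult_less_cancel2)
      then show ?thesis by simp
    qed
    moreover have "a \<in> ?N (x - y)" using uv ad by simp
    ultimately show "a \<in> (\<Union>j\<in>{..d}. {a \<in> ?N j. a < Q})" using a by blast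
  qed
  then have "card ?C \<le> card (\<Union>j\<in>{..d}. {a \<in> ?N j. a < Q})" by (intro card_mono) auto
  also have "\<dots> \<le> (\<Sum>j\<in>{..d}. card {a \<in> ?N j. a < Q})" by (intro card_UN_le) auto
  finally have "card ?C * (t * d) \<le> (\<Sum>j\<in>{..d}. card {a \<in> ?N j. a < Q}) * (t * d)" by simp
  also have "\<dots> = (\<Sum>j\<in>{..d}. card {a \<in> ?N j. a < Q} * (t * d))" by (simp add: sum_distrib_right)
  also have "\<dots> \<le> (\<Sum>j\<in>{..d}. 2 * Q + t * d)"
  proof (rule sum_mono)
    fix j
    have fin: "finite (?N j)"
    proof (rule finite_subset)
      show "?N j \<subseteq> {..j * Q + Q}"
      proof
        fix a assume a: "a \<in> ?N j"
        have "int a * 1 \<le> int a * int d" using d by (intro mult_left_mono) auto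
        moreover have "\<bar>int a * int d - int (j * Q)\<bar> * 1 \<le> \<bar>int a * int d - int (j * Q)\<bar> * int t"
          using t by (intro mult_left_mono) auto
        ultimately have "int a \<le> int (j * Q + Q)" using a by simp
        then show "a \<in> {..j * Q + Q}" by (simp only: of_nat_le_iff atMost_iff)
      qed
    qed simp
    have "card {a \<in> ?N j. a < Q} * (t * d) \<le> card (?N j) * (t * d)"
      using fin by (intro mult_right_mono card_mono) auto
    also have "\<dots> \<le> 2 * Q + t * d" using d t by (intro card_multiples_near_le)
    finally show "card {a \<in> ?N j. a < Q} * (t * d) \<le> 2 * Q + t * d" .
  qed
  also have "\<dots> = Suc d * (2 * Q) + Suc d * (t * d)" by (simp add: algebra_simps)
  \<comment> \<open>Origin of the 5: the window lengths give 4 from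
    \<open>d + 1 \<le> 2 * d\<close>, and the extra point of each window gives one more from
    \<open>(d + 1) * t \<le> n * n \<le> Q\<close>. All of this is plain integer arithmetic, so
    \<open>Q\<close> may be a power of two.\<close>
  also have "\<dots> \<le> (2 * d) * (2 * Q) + (n * n) * d"
  proof (rule add_mono)
    show "Suc d * (2 * Q) \<le> 2 * d * (2 * Q)" using d by (intro mult_right_mono) auto
    have "Suc d * t \<le> n * n" using d t by (intro mult_mono) auto
    then have "Suc d * t * d \<le> n * n * d" by (rule mult_right_mono) simp
    then show "Suc d * (t * d) \<le> n * n * d" by (simp only: mult.assoc)
  qed
  also have "\<dots> \<le> (2 * d) * (2 * Q) + Q * d" using Q by (intro add_left_mono mult_right_mono) auto
  finally have "(card ?C * t) * d \<le> (5 * Q) * d" by (simp add: algebra_simps)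
  then show ?thesis using d by simp
qed

lemma card_collisions_le:
  assumes "i \<noteq> j" "i < n" "j < n" and t: "0 < t" "t \<le> n" and Q: "n * n \<le> Q"
  shows "card {a. a < Q \<and> bucket Q t a i = bucket Q t a j} * t \<le> 5 * Q"
proof (cases "i < j")
  case True
  then show ?thesis using card_collisions_le_aux[of "j - i" i n t Q] assms by simp
next
  case False
  then show ?thesis using card_collisions_le_aux[of "i - j" j n t Q] assms by (simp add: eq_commute)
qed

text \<open>Each of the at most ct other items collides with the queried one for at most a fraction
  5/t of the keys, so at most 5c collisions are expected, and Markov's inequality at 15c gives 1/3.
  The added 1 stands for the queried item itself.\<close>

lemma card_overfull_le:
  assumes X: "finite X" "X \<subseteq> {..<n}" "card X \<le> c * t" and "0 < c" and \<iota>: "\<iota> < n"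
    and t: "0 < t" "t \<le> n" and Q: "n * n \<le> Q"
  shows "3 * card {a. a < Q \<and> 15 * c + 1 < card {i \<in> X. bucket Q t a i = bucket Q t a \<iota>}} \<le> Q"
proof -
  let ?bad = "{a. a < Q \<and> 15 * c + 1 < card {i \<in> X. bucket Q t a i = bucket Q t a \<iota>}}"
  let ?coll = "\<lambda>a. {i \<in> X - {\<iota>}. bucket Q t a i = bucket Q t a \<iota>}"
  have "15 * c * card ?bad = (\<Sum>a\<in>?bad. 15 * c)" by simp
  also have "\<dots> \<le> (\<Sum>a\<in>?bad. card (?coll a))"
  proof (rule sum_mono)
    fix a assume a: "a \<in> ?bad"
    have "{i \<in> X. bucket Q t a i = bucket Q t a \<iota>} \<subseteq> insert \<iota> (?coll a)" by auto
    then have "card {i \<in> X. bucket Q t a i = bucket Q t a \<iota>} \<le> card (insert \<iota> (?coll a))"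
      using X by (intro card_mono) auto
    also have "\<dots> \<le> Suc (card (?coll a))" by (rule card_insert_le_m1) auto
    finally show "15 * c \<le> card (?coll a)" using a by simp
  qed
  also have "\<dots> \<le> (\<Sum>a<Q. card (?coll a))" by (intro sum_mono2) auto
  also have "\<dots> = (\<Sum>a<Q. \<Sum>i\<in>X - {\<iota>}. of_bool (bucket Q t a i = bucket Q t a \<iota>))"
    using X by (simp add: Int_def)
  also have "\<dots> = (\<Sum>i\<in>X - {\<iota>}. \<Sum>a<Q. of_bool (bucket Q t a i = bucket Q t a \<iota>))" by (rule sum.swap)
  also have "\<dots> = (\<Sum>i\<in>X - {\<iota>}. card {a. a < Q \<and> bucket Q t a i = bucket Q t a \<iota>})"
    by (simp add: Int_def)
  finally have "15 * c * card ?bad * t \<le> (\<Sum>i\<in>X - {\<iota>}. card {a. a < Q \<and> bucket Q t a i = bucket Q t a \<iota>} * t)"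
    unfolding sum_distrib_right[symmetric] by (rule mult_right_mono) simp
  also have "\<dots> \<le> (\<Sum>i\<in>X - {\<iota>}. 5 * Q)"
    using X \<iota> t Q by (intro sum_mono card_collisions_le) auto
  also have "\<dots> \<le> c * t * (5 * Q)"
    using X card_Diff1_le[of X \<iota>] by simp
  finally have "(5 * (c * t)) * (3 * card ?bad) \<le> (5 * (c * t)) * Q" by (simp add: mult_ac)
  then show ?thesis using assms by (simp only: mult_le_cancel1) simp
qed

section \<open>The fingerprint verifier\<close>

fun item :: "pq_elem \<Rightarrow> nat" where
  "item (Update i \<delta>) = i"
| "item (Query i) = i"

text \<open>These idealised states keep the exact signed vector \<open>d\<close> of updates minus claims and do not
  depend on the verifier's coins; the verifier itself stores only the image under \<open>compress\<close> below.
  \<open>Running a d q v u\<close> holds the key \<open>a\<close>, the query \<open>q\<close> and the total \<open>v\<close> claimed for the queried item.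
  The buffer \<open>u\<close> of an incomplete block of bits has a leading 1, so \<open>u = 1\<close> when it is empty.\<close>

datatype vstate =
    Rejected
  | Reading_Key "pq_elem option" nat
  | Running nat "nat \<Rightarrow> int" "nat option" int nat

text \<open>Item \<open>i\<close> owns two coins, read as a number from 0 to 3. Four values already
  push the chance of an accidental zero down to 1/4, and the coins can be reread at any time without
  charge to the memory.\<close>

definition coeff :: "bool list \<Rightarrow> nat \<Rightarrow> int" where
  "coeff r i = 2 * of_bool (r ! (2 * i)) + of_bool (r ! (2 * i + 1))"

definition push :: "nat \<Rightarrow> bool \<Rightarrow> nat" where
  "push u c = 2 * u + of_bool c"

text \<open>One word length \<open>L\<close> serves all purposes: \<open>n * n\<close> is the key
  range asked for by the collision bound, and \<open>n * (6 * B + 1)\<close> makes room for a claim,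
  that is, an item together with a residue.\<close>

locale pq_sketch =
  fixes n B t L :: nat
  assumes n: "2 \<le> n" and t: "0 < t" "t \<le> n" and L: "n * n \<le> 2 ^ L" "n * (6 * B + 1) \<le> 2 ^ L"
begin

text \<open>Coprime to \<open>6\<close>, so that differences of two values of \<open>coeff\<close>, which lie between \<open>-3\<close> and \<open>3\<close>,
  are units or zero.\<close>

definition M :: int where "M = 6 * int B + 1"

abbreviation "hash \<equiv> bucket (2 ^ L) t"

definition sketch :: "bool list \<Rightarrow> nat \<Rightarrow> (nat \<Rightarrow> int) \<Rightarrow> nat \<Rightarrow> int" where
  "sketch r a d b = (\<Sum>i | i < n \<and> hash a i = b. d i * coeff r i) mod M"

fun absorb :: "pq_elem \<Rightarrow> vstate \<Rightarrow> vstate" where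
  "absorb (Update i \<delta>) (Running a d None v u) =
     (if i < n then Running a (d(i := d i + \<delta>)) None v u else Rejected)"
| "absorb (Query i) (Running a d None v u) = (if i < n then Running a d (Some i) v u else Rejected)"
| "absorb _ _ = Rejected"

text \<open>A claim \<open>N\<close> packs the item \<open>N mod n\<close> and the value
  \<open>N div n\<close>. No claim is checked by itself: repeated ones for the queried item add up
  in \<open>v\<close>, and one outside the queried bucket leaves that bucket's sketch
  unchanged.\<close>

fun claim :: "nat \<Rightarrow> vstate \<Rightarrow> vstate" where
  "claim N (Running a d (Some q) v u) =
     Running a (d(N mod n := d (N mod n) - int (N div n))) (Some q)
       (v + (if N mod n = q then int (N div n) else 0)) u"
| "claim _ _ = Rejected"

text \<open>The first element waits in \<open>Reading_Key\<close>, since its bucket is unknown until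
  the key is complete. A block is complete when the leading 1 reaches position \<open>L\<close>;
  subtracting \<open>2 ^ L\<close> removes it. Unforeseen tokens, such as annotation bits between
  key and query, lead to rejection.\<close>

fun advance :: "vstate \<Rightarrow> pq_elem token \<Rightarrow> vstate" where
  "advance (Reading_Key None u) (Elem e) = (if item e < n then Reading_Key (Some e) 1 else Rejected)"
| "advance (Reading_Key (Some e) u) (Annot c) =
     (if push u c < 2 ^ L then Reading_Key (Some e) (push u c)
      else absorb e (Running (push u c - 2 ^ L) (\<lambda>_. 0) None 0 1))"
| "advance (Running a d q v u) (Elem e) = absorb e (Running a d q v u)"
| "advance (Running a d (Some q) v u) (Annot c) =
     (if push u c < 2 ^ L then Running a d (Some q) v (push u c)
      else claim (push u c - 2 ^ L) (Running a d (Some q) v 1))"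
| "advance _ _ = Rejected"

definition s0 :: vstate where "s0 = Reading_Key None 1"

text \<open>The representative of \<open>v\<close> modulo \<open>M\<close> in the interval from -3B
  to 3B, which contains all admissible frequencies.\<close>

definition centered :: "int \<Rightarrow> int" where
  "centered v = (v + 3 * int B) mod M - 3 * int B"

fun verdict :: "bool list \<Rightarrow> vstate \<Rightarrow> int option" where
  "verdict r (Running a d (Some q) v u) =
     (if sketch r a d (hash a q) = 0 then Some (centered v) else None)"
| "verdict r _ = None"

fun bounded :: "vstate \<Rightarrow> bool" where
  "bounded Rejected \<longleftrightarrow> True"
| "bounded (Reading_Key x u) \<longleftrightarrow> u < 2 ^ L \<and> (\<forall>e. x = Some e \<longrightarrow> item e < n)"
| "bounded (Running a d q v u) \<longleftrightarrow> a < 2 ^ L \<and> u < 2 ^ L \<and> (\<forall>i. q = Some i \<longrightarrow> i < n)"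

text \<open>The length (0, 1, 2, 3 or \<open>t + 4\<close>) tells the kinds of state apart.
  Increments and totals survive only modulo \<open>M\<close>, and \<open>d\<close> only as
  \<open>t\<close> sketches; the query is shifted by 1 so that 0 can mean that none has
  arrived.\<close>

fun compress :: "bool list \<Rightarrow> vstate \<Rightarrow> int list" where
  "compress r Rejected = []"
| "compress r (Reading_Key None u) = [0]"
| "compress r (Reading_Key (Some (Query i)) u) = [int i, int u]"
| "compress r (Reading_Key (Some (Update i \<delta>)) u) = [int i, int u, \<delta> mod M]"
| "compress r (Running a d q v u) =
     [int a, int u, case q of None \<Rightarrow> 0 | Some i \<Rightarrow> int i + 1, v mod M] @ map (sketch r a d) [0..<t]"

section \<open>Compatibility of the compression with transitions and output\<close>

lemma M_pos: "0 < M" by (simp add: M_def)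

lemma n_less: "n < 2 ^ L"
proof -
  have "n * 2 \<le> n * n" using n by (intro mult_left_mono) auto
  then show ?thesis using n L by linarith
qed

lemma one_less: "1 < (2::nat) ^ L" using n_less n by linarith

lemma M_le: "M \<le> 2 ^ L"
proof -
  have "1 * (6 * B + 1) \<le> n * (6 * B + 1)" using n by (intro mult_right_mono) auto
  then have "6 * B + 1 \<le> 2 ^ L" using L(2) by (simp only: mult_1)
  then have "int (6 * B + 1) \<le> int (2 ^ L)" by (simp only: of_nat_le_iff)
  then show ?thesis by (simp add: M_def)
qed

lemma hash_less: "hash a i < t" using t by (intro bucket_less) auto

lemma sketch_upd:
  assumes "i < n"
  shows "sketch r a (d(i := d i + x)) b = (sketch r a d b + (if hash a i = b then x * coeff r i else 0)) mod M"
proof -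
  let ?S = "{j. j < n \<and> hash a j = b}"
  have "(\<Sum>j\<in>?S. (d(i := d i + x)) j * coeff r j) =
      (\<Sum>j\<in>?S. d j * coeff r j + (if j = i then x * coeff r i else 0))"
    by (intro sum.cong) (auto simp: algebra_simps)
  also have "\<dots> = (\<Sum>j\<in>?S. d j * coeff r j) + (if hash a i = b then x * coeff r i else 0)"
    using assms by (simp add: sum.distrib sum.delta)
  finally show ?thesis unfolding sketch_def by (simp add: mod_add_left_eq)
qed

lemma compress_Running_eq:
  "compress r (Running a d q v u) = compress r (Running a' d' q' v' u') \<longleftrightarrow>
     a = a' \<and> u = u' \<and> q = q' \<and> v mod M = v' mod M \<and> (\<forall>b<t. sketch r a d b = sketch r a' d' b)"
  by (auto split: option.splits)

lemma bounded_absorb: "bounded s \<Longrightarrow> bounded (absorb e s)"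
  by (cases "(e, s)" rule: absorb.cases) auto

lemma bounded_claim: "bounded s \<Longrightarrow> bounded (claim N s)"
  by (cases "(N, s)" rule: claim.cases) auto

lemma bounded_advance:
  assumes "bounded s"
  shows "bounded (advance s x)"
proof -
  have *: "push u c - 2 ^ L < 2 ^ L" if "u < 2 ^ L" for u c
    using that by (auto simp: push_def)
  show ?thesis using assms one_less
    by (cases "(s, x)" rule: advance.cases) (auto intro!: bounded_absorb bounded_claim *)
qed

lemma compress_absorb_cong:
  assumes "compress r (Running a d q v u) = compress r (Running a d' q v' u)"
  shows "compress r (absorb e (Running a d q v u)) = compress r (absorb e (Running a d' q v' u))"
proof (cases e)
  case (Update i \<delta>)
  show ?thesis
  proof (cases "q = None \<and> i < n")
    case True
    then show ?thesis using assms unfolding Update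
      by (simp add: compress_Running_eq sketch_upd del: compress.simps(5))
  qed (use Update in \<open>auto split: option.splits intro: option.exhaust[of q]\<close>)
next
  case (Query i)
  show ?thesis
  proof (cases "q = None \<and> i < n")
    case True
    then show ?thesis using assms unfolding Query
      by (simp add: compress_Running_eq del: compress.simps(5))
  qed (use Query in \<open>auto split: option.splits intro: option.exhaust[of q]\<close>)
qed

lemma compress_claim_cong:
  assumes "compress r (Running a d q v u) = compress r (Running a d' q v' u)"
  shows "compress r (claim N (Running a d q v u)) = compress r (claim N (Running a d' q v' u))"
proof (cases q)
  case (Some i)
  have "N mod n < n" using n by simp
  moreover have "(v + x) mod M = (v' + x) mod M" for x
    using assms unfolding compress_Running_eq by (intro mod_add_cong) simp_all
  ultimately show ?thesis using assms unfolding Some claim.simps compress_Running_eq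
    using sketch_upd[of "N mod n" r a _ "- int (N div n)"] by simp
qed simp

text \<open>Control flow looks only at parts of the state that are stored exactly; \<open>d\<close>,
  \<open>v\<close> and a waiting increment enter through linear expressions modulo
  \<open>M\<close>.\<close>

lemma compress_advance_cong:
  assumes "compress r s = compress r s'"
  shows "compress r (advance s x) = compress r (advance s' x)"
proof (cases s)
  case s: Rejected
  then have "s' = Rejected" using assms by (cases "(r, s')" rule: compress.cases) auto
  then show ?thesis using s by simp
next
  case s: (Reading_Key y u)
  show ?thesis
  proof (cases y)
    case None
    then obtain u' where "s' = Reading_Key None u'"
      using s assms t by (cases "(r, s')" rule: compress.cases) auto
    then show ?thesis using s None by (cases x) auto
  next
    case (Some e)
    show ?thesis
    proof (cases e)
      case (Query i)
      then have "s' = s" using s Some assms t by (cases "(r, s')" rule: compress.cases) auto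
      then show ?thesis by simp
    next
      case (Update i \<delta>)
      have "compress r s' = [int i, int u, \<delta> mod M]" using s Some Update assms by simp
      \<comment> \<open>Here \<open>s'\<close> may differ from \<open>s\<close>: the increments of
        the two waiting updates agree only modulo \<open>M\<close>.\<close>
      then have "\<exists>\<delta>'. s' = Reading_Key (Some (Update i \<delta>')) u \<and> \<delta> mod M = \<delta>' mod M"
        using t by (cases "(r, s')" rule: compress.cases) simp_all
      then obtain \<delta>' where s': "s' = Reading_Key (Some (Update i \<delta>')) u" "\<delta> mod M = \<delta>' mod M"
        by blast
      show ?thesis
      proof (cases x)
        case (Annot c)
        have "compress r (absorb (Update i \<delta>) (Running a (\<lambda>_. 0) None 0 1)) =
            compress r (absorb (Update i \<delta>') (Running a (\<lambda>_. 0) None 0 1))" for a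
        proof (cases "i < n")
          case True
          have "(z + (if hash a i = b then \<delta> * w else 0)) mod M = (z + (if hash a i = b then \<delta>' * w else 0)) mod M"
            for z w b using s'(2) by (intro mod_add_cong) (auto intro: mod_mult_cong)
          with True show ?thesis
            using sketch_upd[OF True, of r a "\<lambda>_. 0"] by (simp add: compress_Running_eq del: compress.simps(5))
        qed simp
        then show ?thesis using s Some Update s' Annot by simp
      qed (use s Some Update s' in simp)
    qed
  qed
next
  case s: (Running a d q v u)
  then obtain d' v' where s': "s' = Running a d' q v' u"
    using assms t by (cases "(r, s')" rule: compress.cases) (auto split: option.splits)
  have eq: "compress r (Running a d q v u) = compress r (Running a d' q v' u)" using assms s s' by simp
  show ?thesis
  proof (cases x)
    case (Elem e)
    then show ?thesis using compress_absorb_cong[OF eq] s s' by simp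
  next
    case (Annot c)
    show ?thesis
    proof (cases q)
      case None
      then show ?thesis using s s' Annot by simp
    next
      case (Some i)
      have eq': "compress r (Running a d q v u') = compress r (Running a d' q v' u')" for u'
        using eq by (simp add: compress_Running_eq del: compress.simps(5))
      show ?thesis using compress_claim_cong[OF eq'[of 1]] eq' s s' Some Annot
        by (simp del: compress.simps(5) claim.simps)
    qed
  qed
qed

lemma verdict_cong:
  assumes "compress r s = compress r s'"
  shows "verdict r s = verdict r s'"
proof (cases s)
  case s: Rejected
  then have "s' = Rejected" using assms by (cases "(r, s')" rule: compress.cases) auto
  then show ?thesis using s by simp
next
  case s: (Reading_Key y u)
  then have "length (compress r s) \<in> {1, 2, 3}"
    by (cases "(r, s)" rule: compress.cases) auto
  then have "length (compress r s') \<in> {1, 2, 3}" using assms by simp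
  then obtain y' u' where "s' = Reading_Key y' u'"
    using t by (cases s') auto
  then show ?thesis using s by simp
next
  case s: (Running a d q v u)
  then obtain d' v' where s': "s' = Running a d' q v' u"
    using assms t by (cases "(r, s')" rule: compress.cases) (auto split: option.splits)
  have eq: "compress r (Running a d q v u) = compress r (Running a d' q v' u)" using assms s s' by simp
  then have "(v + 3 * int B) mod M = (v' + 3 * int B) mod M"
    unfolding compress_Running_eq by (intro mod_add_cong) simp_all
  with eq show ?thesis unfolding s s' compress_Running_eq
    by (cases q) (simp_all add: hash_less centered_def)
qed

lemma compress_in:
  assumes "bounded s"
  shows "compress r s \<in> {xs. set xs \<subseteq> {0..<2 ^ L} \<and> length xs \<le> t + 4}"
proof -
  have sk: "sketch r a d b \<in> {0..<2 ^ L}" for a d b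
    using M_pos M_le unfolding sketch_def by (auto intro: less_le_trans[OF pos_mod_bound])
  have md: "x mod M \<in> {0..<2 ^ L}" for x
    using M_pos M_le by (auto intro: less_le_trans[OF pos_mod_bound])
  have lt: "int x < 2 ^ L" if "x < 2 ^ L" for x using that by (metis of_nat_less_iff of_nat_numeral of_nat_power)
  have li: "int i + 1 < 2 ^ L" "int i < 2 ^ L" if "i < n" for i
    using that n_less lt[of "Suc i"] lt[of i] by auto
  show ?thesis using assms sk md lt li
    by (cases "(r, s)" rule: compress.cases) (auto split: option.splits)
qed

text \<open>There are at most (2^L)^(t + 5) lists of length at most t + 4 over 2^L symbols, hence
  the \<open>L * (t + 5)\<close> bits.\<close>

lemma machine:
  obtains start :: "bool list \<Rightarrow> bool list" and step :: "bool list \<Rightarrow> bool list \<Rightarrow> pq_elem token \<Rightarrow> bool list"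
    and answer :: "bool list \<Rightarrow> bool list \<Rightarrow> int option"
  where "\<And>r. start r \<in> bitstrings (L * (t + 5))"
    "\<And>r s t'. s \<in> bitstrings (L * (t + 5)) \<Longrightarrow> step r s t' \<in> bitstrings (L * (t + 5))"
    "\<And>r ts. answer r (foldl (step r) (start r) ts) = verdict r (foldl advance s0 ts)"
proof (rule scheme_of_compression[of bounded s0 advance compress verdict
      "{xs. set xs \<subseteq> {0..<2 ^ L} \<and> length xs \<le> t + 4}" "L * (t + 5)"])
  show "bounded s0" using one_less by (simp add: s0_def)
  have "card {xs. set xs \<subseteq> {0..<2 ^ L :: int} \<and> length xs \<le> t + 4} \<le> (2 ^ L) ^ Suc (t + 4)"
    using one_less by (intro card_bounded_lists_le) (auto simp: nat_power_eq)
  then show "card {xs. set xs \<subseteq> {0..<2 ^ L :: int} \<and> length xs \<le> t + 4} \<le> 2 ^ (L * (t + 5))"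
    by (simp add: power_mult add.commute)
qed (auto intro: bounded_advance compress_advance_cong verdict_cong finite_lists_length_le simp: compress_in[simplified])

end

section \<open>Correctness of the fingerprint scheme\<close>

fun elems :: "'x token list \<Rightarrow> 'x list" where
  "elems [] = []"
| "elems (Elem e # ts) = e # elems ts"
| "elems (Annot c # ts) = elems ts"

lemma elems_append: "elems (ts @ us) = elems ts @ elems us"
  by (induction ts rule: elems.induct) auto

lemma elems_annots [simp]: "elems (map Annot a) = []"
  by (induction a) auto

lemma elems_interleave: "length xs = length as \<Longrightarrow> elems (interleave xs as) = xs"
  by (induction xs as rule: list_induct2) (auto simp: elems_append)

definition num :: "bool list \<Rightarrow> nat" where
  "num p = foldl push 0 p"

lemma num_Nil [simp]: "num [] = 0" by (simp add: num_def)

lemma num_snoc [simp]: "num (p @ [c]) = 2 * num p + of_bool c"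
  by (simp add: num_def push_def)

lemma num_less: "num p < 2 ^ length p"
  by (induction p rule: rev_induct) auto

lemma foldl_push: "foldl push u p = u * 2 ^ length p + num p"
  by (induction p rule: rev_induct) (auto simp: push_def)

lemma num_inject: "length p = length q \<Longrightarrow> num p = num q \<Longrightarrow> p = q"
proof (induction p arbitrary: q rule: rev_induct)
  case (snoc c p)
  then obtain q' c' where q: "q = q' @ [c']" by (cases q rule: rev_cases) auto
  with snoc.prems have *: "2 * num p + of_bool c = 2 * num q' + of_bool c'" by simp
  have "c = c'"
  proof -
    have "(2 * num p + of_bool c) mod 2 = (2 * num q' + of_bool c') mod 2" using * by simp
    then show ?thesis by (cases c; cases c') auto
  qed
  with * snoc q show ?case by simp
qed simp

text \<open>Turns a uniform bit string into a uniform key, so that a count of bad keys bounds the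
  count of bad prover strings.\<close>

lemma bij_betw_num: "bij_betw num (bitstrings l) {..<2 ^ l}"
proof -
  have "inj_on num (bitstrings l)" by (auto simp: inj_on_def bitstrings_def intro: num_inject)
  moreover have "num ` bitstrings l \<subseteq> {..<2 ^ l}"
    using num_less by (auto simp: bitstrings_def)
  ultimately have "num ` bitstrings l = {..<2 ^ l}"
    by (intro card_subset_eq) (auto simp: card_image)
  with \<open>inj_on num (bitstrings l)\<close> show ?thesis by (simp add: bij_betw_def)
qed

lemma pq_inputs_cases:
  assumes "x \<in> pq_inputs n B"
  obtains us \<iota> where "x = us @ [Query \<iota>]" "\<iota> < n" "\<And>e. e \<in> set us \<Longrightarrow> \<exists>i \<delta>. e = Update i \<delta> \<and> i < n"
    "\<And>i. \<bar>freq x i\<bar> \<le> int B"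
proof -
  from assms obtain us \<iota> where *: "x = map (\<lambda>(i, \<delta>). Update i \<delta>) us @ [Query \<iota>]"
    "fst ` set us \<subseteq> {..<n}" "\<iota> < n" "\<forall>i. \<bar>freq x i\<bar> \<le> int B"
    unfolding pq_inputs_def by blast
  show thesis by (rule that[OF *(1,3)]) (use * in auto)
qed

lemma freq_updates_eq_0:
  assumes "\<And>e. e \<in> set us \<Longrightarrow> \<exists>j \<delta>. e = Update j \<delta> \<and> j < n" "n \<le> i"
  shows "freq us i = 0"
  using assms(1) by (induction us) (use assms(2) in \<open>fastforce simp: freq_Cons\<close>)+

section \<open>Soundness against arbitrary annotations\<close>

context pq_sketch
begin

text \<open>An invariant under every annotation: a claim for the queried item moves its value from
  \<open>d q\<close> to \<open>v\<close>, so their sum stays the true frequency.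
  \<open>Query q \<in> set xs\<close> later identifies \<open>q\<close> with the index queried at
  the end.\<close>

fun consistent :: "pq_elem list \<Rightarrow> vstate \<Rightarrow> bool" where
  "consistent xs Rejected \<longleftrightarrow> True"
| "consistent xs (Reading_Key None u) \<longleftrightarrow> xs = []"
| "consistent xs (Reading_Key (Some e) u) \<longleftrightarrow> xs = [e]"
| "consistent xs (Running a d None v u) \<longleftrightarrow> v = 0 \<and> (\<forall>i. d i = freq xs i)"
| "consistent xs (Running a d (Some q) v u) \<longleftrightarrow> Query q \<in> set xs \<and> q < n \<and> d q + v = freq xs q"

lemma consistent_absorb:
  assumes "consistent xs (Running a d q v u)"
  shows "consistent (xs @ [e]) (absorb e (Running a d q v u))"
  using assms by (cases e; cases q) (auto simp: freq_append freq_Cons)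

lemma consistent_elem:
  assumes "consistent xs s"
  shows "consistent (xs @ [e]) (advance s (Elem e))"
proof (cases s)
  case (Reading_Key y u)
  then show ?thesis using assms by (cases y) auto
qed (use assms consistent_absorb in auto)

lemma consistent_annot:
  assumes "consistent xs s"
  shows "consistent xs (advance s (Annot c))"
proof (cases s)
  case (Reading_Key y u)
  have "consistent ([] @ [e]) (absorb e (Running a (\<lambda>_. 0) None 0 w))" for a e w
    by (rule consistent_absorb) simp
  then show ?thesis using assms Reading_Key by (cases y) auto
next
  case (Running a d q v u)
  then show ?thesis using assms by (cases q) auto
qed simp

lemma consistent_foldl: "consistent (elems ts) (foldl advance s0 ts)"
proof (induction ts rule: rev_induct)
  case Nil
  then show ?case by (simp add: s0_def)
next
  case (snoc t ts)
  then show ?case by (cases t) (auto simp: elems_append intro: consistent_elem consistent_annot)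
qed

lemma centered_eq:
  assumes "v mod M = f mod M" "\<bar>f\<bar> \<le> int B"
  shows "centered v = f"
proof -
  have "(v + 3 * int B) mod M = (f + 3 * int B) mod M"
    using assms(1) by (intro mod_add_cong) simp_all
  also have "\<dots> = f + 3 * int B"
    using assms(2) by (intro mod_pos_pos_trivial) (auto simp: M_def)
  finally show ?thesis by (simp add: centered_def)
qed

text \<open>Modulo \<open>M\<close> the product of 6 and \<open>B\<close> is -1, so every divisor of
  6 is a unit with an explicit inverse, even for composite \<open>M\<close>.\<close>

lemma M_dvd_cancel:
  assumes "M dvd x * y" "y dvd 6"
  shows "M dvd x"
proof -
  from assms(2) obtain z where z: "6 = y * z" ..
  have "M dvd x * y * z * int B" by (rule dvd_mult2[OF dvd_mult2[OF assms(1)]])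
  also have "x * y * z * int B = x * (6 * int B)" by (simp add: z mult.assoc)
  finally have "M dvd x * (6 * int B)" .
  moreover have "x = x * M - x * (6 * int B)" by (simp add: M_def algebra_simps)
  ultimately show ?thesis by (metis dvd_diff dvd_triv_right)
qed

text \<open>Changing the two random bits of item \<open>j\<close> moves the sum through four distinct residues.\<close>

lemma card_sketch_zero_le:
  assumes j: "j < n" and d: "\<not> M dvd d j"
  shows "4 * card {r \<in> bitstrings (2 * n). sketch r a d (hash a j) = 0} \<le> 2 ^ (2 * n)"
proof -
  let ?Z = "{r \<in> bitstrings (2 * n). sketch r a d (hash a j) = 0}"
  let ?I = "{i. i < n \<and> hash a i = hash a j}"
  let ?f = "\<lambda>(r :: bool list, x, y). r[2 * j := x, 2 * j + 1 := y]"
  \<comment> \<open>The factor 4: each string in \<open>?Z\<close> yields four strings by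
    overwriting the two coins of \<open>j\<close>, and injectivity says that these families are
    disjoint.\<close>
  have "inj_on ?f (?Z \<times> UNIV)"
  proof (rule inj_onI)
    fix z z' assume z: "z \<in> ?Z \<times> UNIV" "z' \<in> ?Z \<times> UNIV" "?f z = ?f z'"
    obtain r x y r' x' y' where zs: "z = (r, x, y)" "z' = (r', x', y')"
      by (metis prod.exhaust)
    have r: "r \<in> bitstrings (2 * n)" "sketch r a d (hash a j) = 0"
      and r': "r' \<in> bitstrings (2 * n)" "sketch r' a d (hash a j) = 0"
      and eq: "r[2 * j := x, 2 * j + 1 := y] = r'[2 * j := x', 2 * j + 1 := y']"
      using z by (simp_all add: zs)
    have len: "length r = 2 * n" "length r' = 2 * n" using r r' by (auto simp: bitstrings_def)
    have nth: "r[2 * j := x, 2 * j + 1 := y] ! k = r'[2 * j := x', 2 * j + 1 := y'] ! k" for k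
      using eq by simp
    have "y = y'" "x = x'" using nth[of "2 * j + 1"] nth[of "2 * j"] len j by simp_all
    have other: "r ! k = r' ! k" if "k \<noteq> 2 * j" "k \<noteq> 2 * j + 1" for k
      using nth[of k] that by simp
    have "coeff r i = coeff r' i" if "i \<noteq> j" for i
    proof -
      have "2 * i \<noteq> 2 * j + 1" "2 * i + 1 \<noteq> 2 * j" by presburger+
      then show ?thesis using that by (simp add: coeff_def other)
    qed
    then have "(\<Sum>i\<in>?I. d i * coeff r i) - (\<Sum>i\<in>?I. d i * coeff r' i) =
        (\<Sum>i\<in>?I. if i = j then d j * (coeff r j - coeff r' j) else 0)"
      unfolding sum_subtractf[symmetric] by (intro sum.cong) (auto simp: algebra_simps)
    also have "\<dots> = d j * (coeff r j - coeff r' j)" using j by simp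
    finally have diff: "(\<Sum>i\<in>?I. d i * coeff r i) - (\<Sum>i\<in>?I. d i * coeff r' i) =
        d j * (coeff r j - coeff r' j)" .
    have "M dvd (\<Sum>i\<in>?I. d i * coeff r i)" "M dvd (\<Sum>i\<in>?I. d i * coeff r' i)"
      using r(2) r'(2) by (simp_all only: sketch_def mod_eq_0_iff_dvd)
    from dvd_diff[OF this] have "M dvd d j * (coeff r j - coeff r' j)" by (simp only: diff)
    \<comment> \<open>The nonzero differences are 1, 2, 3 up to sign and all divide 6, so the
      coefficients are equal, and hence so are the coins.\<close>
    then have "\<not> (coeff r j - coeff r' j) dvd 6" using M_dvd_cancel d by blast
    then have "r ! (2 * j) = r' ! (2 * j)" "r ! (2 * j + 1) = r' ! (2 * j + 1)"
      by (cases "r ! (2 * j)"; cases "r ! (2 * j + 1)"; cases "r' ! (2 * j)"; cases "r' ! (2 * j + 1)";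
          simp add: coeff_def)+
    with other have "r ! k = r' ! k" for k by (cases "k = 2 * j"; cases "k = 2 * j + 1") auto
    then have "r = r'" using len by (simp add: nth_equalityI)
    with \<open>x = x'\<close> \<open>y = y'\<close> show "z = z'" by (simp add: zs)
  qed
  moreover have "?f ` (?Z \<times> UNIV) \<subseteq> bitstrings (2 * n)" by (auto simp: bitstrings_def)
  ultimately have "card (?Z \<times> (UNIV :: (bool \<times> bool) set)) \<le> card (bitstrings (2 * n))"
    by (rule card_inj_on_le) simp
  moreover have "card (UNIV :: (bool \<times> bool) set) = 4"
    by (simp flip: UNIV_Times_UNIV)
  ultimately show ?thesis by (simp add: card_cartesian_product)
qed

text \<open>The annotations are fixed before the coins are drawn and \<open>advance\<close> does not
  see the coins, so a single vector \<open>d\<close> is fingerprinted. If \<open>M\<close> divides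
  \<open>d \<iota>\<close>, then \<open>v\<close> has the right residue and any value output is
  correct; otherwise acceptance needs an accidental zero.\<close>

lemma soundness:
  assumes x: "x \<in> pq_inputs n B" and len: "length as = length x"
  shows "4 * card {r \<in> bitstrings (2 * n).
      verdict r (foldl advance s0 (interleave x as)) \<notin> {Some (point_query x), None}} \<le> 2 ^ (2 * n)"
proof -
  from x obtain us \<iota> where xu: "x = us @ [Query \<iota>]" "\<iota> < n"
    "\<And>e. e \<in> set us \<Longrightarrow> \<exists>i \<delta>. e = Update i \<delta> \<and> i < n" "\<And>i. \<bar>freq x i\<bar> \<le> int B"
    by (rule pq_inputs_cases) blast
  have pq: "point_query x = freq x \<iota>" by (simp add: point_query_def xu(1))
  have con: "consistent x (foldl advance s0 (interleave x as))"
    using consistent_foldl[of "interleave x as"] len by (simp add: elems_interleave)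
  let ?E = "{r \<in> bitstrings (2 * n).
      verdict r (foldl advance s0 (interleave x as)) \<notin> {Some (point_query x), None}}"
  have "?E = {} \<or> (\<exists>a d. \<not> M dvd d \<iota> \<and> ?E \<subseteq> {r \<in> bitstrings (2 * n). sketch r a d (hash a \<iota>) = 0})"
  proof (cases "\<exists>a d q v u. foldl advance s0 (interleave x as) = Running a d (Some q) v u")
    case False
    then have "verdict r (foldl advance s0 (interleave x as)) = None" for r
      by (cases "(r, foldl advance s0 (interleave x as))" rule: verdict.cases) auto
    then show ?thesis by simp
  next
    case True
    then obtain a d q v u where s: "foldl advance s0 (interleave x as) = Running a d (Some q) v u" by blast
    have "Query q \<in> set x" "d q + v = freq x q" using con s by auto
    moreover have "q = \<iota>" using \<open>Query q \<in> set x\<close> xu(1) xu(3)[of "Query q"] by auto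
    ultimately have dv: "d \<iota> + v = freq x \<iota>" by simp
    show ?thesis
    proof (cases "M dvd d \<iota>")
      case True
      then have "v mod M = freq x \<iota> mod M" using dv by (metis add.commute dvd_imp_mod_0 mod_add_right_eq add.right_neutral)
      then have "centered v = freq x \<iota>" by (rule centered_eq) (rule xu(4))
      then show ?thesis by (simp add: s pq)
    next
      case False
      have "?E \<subseteq> {r \<in> bitstrings (2 * n). sketch r a d (hash a \<iota>) = 0}"
        using \<open>q = \<iota>\<close> by (auto simp: s)
      with False show ?thesis by blast
    qed
  qed
  then show ?thesis
  proof
    assume "\<exists>a d. \<not> M dvd d \<iota> \<and> ?E \<subseteq> {r \<in> bitstrings (2 * n). sketch r a d (hash a \<iota>) = 0}"
    then obtain a d where "\<not> M dvd d \<iota>" and sub: "?E \<subseteq> {r \<in> bitstrings (2 * n). sketch r a d (hash a \<iota>) = 0}"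
      by blast
    from card_mono[OF _ sub] have "card ?E \<le> card {r \<in> bitstrings (2 * n). sketch r a d (hash a \<iota>) = 0}" by simp
    with card_sketch_zero_le[where d = d and a = a, OF xu(2) \<open>\<not> M dvd d \<iota>\<close>] show ?thesis by linarith
  next
    assume empty: "?E = {}"
    show ?thesis unfolding empty by simp
  qed
qed

section \<open>The honest prover and completeness\<close>

definition block :: "nat \<Rightarrow> bool list" where
  "block = inv_into (bitstrings L) num"

definition claimed_items :: "pq_elem list \<Rightarrow> nat \<Rightarrow> nat \<Rightarrow> nat list" where
  "claimed_items x a \<iota> = filter (\<lambda>i. hash a i = hash a \<iota> \<and> freq x i \<noteq> 0) [0..<n]"

text \<open>An overfull bucket is answered by no claims at all, which bounds the annotation length
  for every key. Values are sent as residues so that they are nonnegative and fit into a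
  block.\<close>

definition claims :: "nat \<Rightarrow> pq_elem list \<Rightarrow> nat \<Rightarrow> nat \<Rightarrow> nat list" where
  "claims K x a \<iota> = (if length (claimed_items x a \<iota>) \<le> K
     then map (\<lambda>i. i + n * nat (freq x i mod M)) (claimed_items x a \<iota>) else [])"

text \<open>Position 0 receives the key even if it is already the query; then key and claims share
  one annotation. The prefix \<open>take (Suc i) x\<close> makes onlineness immediate and is all of
  \<open>x\<close> at the final query.\<close>

definition prover :: "nat \<Rightarrow> pq_elem list \<Rightarrow> bool list \<Rightarrow> nat \<Rightarrow> bool list" where
  "prover K x p i = (if i = 0 then p else []) @
     (case x ! i of Update _ _ \<Rightarrow> []
      | Query \<iota> \<Rightarrow> concat (map block (claims K (take (Suc i) x) (num p) \<iota>)))"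

lemma block: "N < 2 ^ L \<Longrightarrow> length (block N) = L" "N < 2 ^ L \<Longrightarrow> num (block N) = N"
proof -
  assume "N < 2 ^ L"
  then have "N \<in> num ` bitstrings L" using bij_betw_num[of L] by (simp add: bij_betw_def)
  from inv_into_into[OF this] f_inv_into_f[OF this]
  show "length (block N) = L" "num (block N) = N" unfolding block_def by (simp_all add: bitstrings_def)
qed

lemma L_pos: "0 < L" using one_less by (cases L) auto

lemma read_partial_key:
  "length p < L \<Longrightarrow> foldl advance (Reading_Key (Some e) 1) (map Annot p) = Reading_Key (Some e) (foldl push 1 p)"
proof (induction p rule: rev_induct)
  case (snoc c p)
  have "foldl push 1 (p @ [c]) < 2 ^ Suc (length (p @ [c]))"
    using num_less[of "p @ [c]"] by (simp only: foldl_push) simp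
  also have "\<dots> \<le> 2 ^ L" using snoc.prems by (intro power_increasing) auto
  finally show ?case using snoc by simp
qed simp

lemma read_key:
  assumes "length p = L"
  shows "foldl advance (Reading_Key (Some e) 1) (map Annot p) = absorb e (Running (num p) (\<lambda>_. 0) None 0 1)"
proof -
  obtain p' c where p: "p = p' @ [c]" using assms L_pos by (cases p rule: rev_cases) auto
  have "L = Suc (length p')" using p assms by simp
  then have "push (foldl push 1 p') c = 2 ^ L + num p"
    using foldl_push[of 1 p] p by simp
  then show ?thesis using read_partial_key[of p' e] assms p by simp
qed

lemma read_partial_claim:
  "length p < L \<Longrightarrow> foldl advance (Running a d (Some q) v 1) (map Annot p) = Running a d (Some q) v (foldl push 1 p)"
proof (induction p rule: rev_induct)
  case (snoc c p)
  have "foldl push 1 (p @ [c]) < 2 ^ Suc (length (p @ [c]))"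
    using num_less[of "p @ [c]"] by (simp only: foldl_push) simp
  also have "\<dots> \<le> 2 ^ L" using snoc.prems by (intro power_increasing) auto
  finally show ?case using snoc by simp
qed simp

lemma read_claim:
  assumes "length p = L"
  shows "foldl advance (Running a d (Some q) v 1) (map Annot p) = claim (num p) (Running a d (Some q) v 1)"
proof -
  obtain p' c where p: "p = p' @ [c]" using assms L_pos by (cases p rule: rev_cases) auto
  have "L = Suc (length p')" using p assms by simp
  then have "push (foldl push 1 p') c = 2 ^ L + num p"
    using foldl_push[of 1 p] p by simp
  then show ?thesis using read_partial_claim[of p' a d q v] assms p by simp
qed

lemma read_updates:
  assumes "\<And>e. e \<in> set us \<Longrightarrow> \<exists>i \<delta>. e = Update i \<delta> \<and> i < n"
  shows "foldl advance (Running a d None v u) (map Elem us) = Running a (\<lambda>i. d i + freq us i) None v u"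
  using assms
proof (induction us arbitrary: d)
  case (Cons e us)
  then obtain i \<delta> where e: "e = Update i \<delta>" "i < n" by (metis list.set_intros(1))
  have "(\<lambda>j. (d(i := d i + \<delta>)) j + freq us j) = (\<lambda>j. d j + freq (e # us) j)"
    by (auto simp: e freq_Cons)
  with Cons e show ?case by simp
qed simp

lemma claim_less:
  assumes "i < n"
  shows "i + n * nat (z mod M) < 2 ^ L"
proof -
  have "z mod M < int (6 * B + 1)" using pos_mod_bound[OF M_pos, of z] by (simp add: M_def)
  then have "nat (z mod M) + 1 \<le> 6 * B + 1" by linarith
  then have "n * (nat (z mod M) + 1) \<le> n * (6 * B + 1)" by (rule mult_left_mono) simp
  also have "\<dots> \<le> 2 ^ L" by (rule L(2))
  finally show ?thesis using assms by simp
qed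

text \<open>For \<open>d = f\<close> each listed coordinate becomes a multiple of \<open>M\<close>;
  distinctness ensures that it is reduced only once. The total \<open>v'\<close> is left open
  because \<open>consistent_foldl\<close> determines it.\<close>

lemma read_claims:
  assumes "distinct is" "set is \<subseteq> {..<n}"
  shows "\<exists>v'. foldl advance (Running a d (Some q) v 1)
      (map Annot (concat (map block (map (\<lambda>i. i + n * nat (f i mod M)) is)))) =
      Running a (\<lambda>i. if i \<in> set is then d i - f i mod M else d i) (Some q) v' 1"
  using assms
proof (induction "is" arbitrary: d v)
  case (Cons i "is")
  let ?N = "i + n * nat (f i mod M)"
  have i: "i < n" and "is": "distinct is" "set is \<subseteq> {..<n}" using Cons.prems by simp_all
  have f: "0 \<le> f i mod M" "f i mod M < M" using M_pos by auto
  have N: "?N mod n = i" "int (?N div n) = f i mod M" using i f by auto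
  note b = block[OF claim_less[OF i, of "f i"]]
  define v1 where "v1 = v + (if i = q then f i mod M else 0)"
  have "foldl advance (Running a d (Some q) v 1) (map Annot (block ?N)) =
      Running a (d(i := d i - f i mod M)) (Some q) v1 1"
    unfolding read_claim[OF b(1)] b(2) claim.simps N v1_def ..
  moreover obtain v' where "foldl advance (Running a (d(i := d i - f i mod M)) (Some q) v1 1)
      (map Annot (concat (map block (map (\<lambda>i. i + n * nat (f i mod M)) is)))) =
      Running a (\<lambda>j. if j \<in> set is then (d(i := d i - f i mod M)) j - f j mod M else (d(i := d i - f i mod M)) j)
        (Some q) v' 1"
    using Cons.IH[OF "is", of "d(i := d i - f i mod M)" v1] by blast
  moreover have "(\<lambda>j. if j \<in> set is then (d(i := d i - f i mod M)) j - f j mod M else (d(i := d i - f i mod M)) j) =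
      (\<lambda>j. if j \<in> set (i # is) then d j - f j mod M else d j)"
    using Cons.prems by auto
  ultimately show ?case by auto
qed simp

lemma interleave_prover:
  assumes x: "x = us @ [Query \<iota>]" and us: "\<And>e. e \<in> set us \<Longrightarrow> \<exists>i \<delta>. e = Update i \<delta> \<and> i < n"
  shows "interleave x (map (prover K x p) [0..<length x]) =
    Elem (hd x) # map Annot p @ map Elem (tl x) @ map Annot (concat (map block (claims K x (num p) \<iota>)))"
proof (cases us)
  case Nil
  then show ?thesis by (simp add: x prover_def)
next
  case (Cons e es)
  have upd: "prover K x p i = (if i = 0 then p else [])" if i: "i < length us" for i
  proof -
    have "x ! i = us ! i" using i x by (simp add: nth_append)
    moreover obtain j \<delta> where "us ! i = Update j \<delta>" using us[OF nth_mem[OF i]] by blast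
    ultimately show ?thesis by (simp add: prover_def)
  qed
  have last: "prover K x p (length us) = concat (map block (claims K x (num p) \<iota>))"
    using Cons by (simp add: prover_def x)
  have "map (prover K x p) [0..<length x] = map (prover K x p) [0..<length us] @ [prover K x p (length us)]"
    by (simp add: x)
  also have "map (prover K x p) [0..<length us] = p # replicate (length es) []"
    using Cons by (intro nth_equalityI) (simp_all add: upd nth_Cons' del: upt_Suc)
  finally have eq: "map (prover K x p) [0..<length x] = p # replicate (length es) [] @ [concat (map block (claims K x (num p) \<iota>))]"
    by (simp add: last)
  have "interleave es (replicate (length es) []) = map Elem es" for es :: "pq_elem list"
    by (induction es) auto
  then show ?thesis unfolding eq by (simp add: x Cons interleave_append)
qed

text \<open>After the claims, \<open>M\<close> divides every coordinate of the queried bucket, the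
  unclaimed ones being 0. The sketch then vanishes for all verifier coins, so the key is the only
  source of completeness error.\<close>

lemma completeness:
  assumes x: "x \<in> pq_inputs n B" "last x = Query \<iota>" and p: "length p = L"
    and few: "length (claimed_items x (num p) \<iota>) \<le> K"
  shows "verdict r (foldl advance s0 (interleave x (map (prover K x p) [0..<length x]))) = Some (point_query x)"
proof -
  from x(1) obtain us \<iota>' where xu: "x = us @ [Query \<iota>']" "\<iota>' < n"
    "\<And>e. e \<in> set us \<Longrightarrow> \<exists>i \<delta>. e = Update i \<delta> \<and> i < n" "\<And>i. \<bar>freq x i\<bar> \<le> int B"
    by (rule pq_inputs_cases) blast
  have \<iota>: "\<iota>' = \<iota>" using xu x by simp
  have fx: "freq us i = freq x i" for i by (simp add: xu(1) freq_append freq_Cons)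
  have pq: "point_query x = freq x \<iota>" using x(2) by (simp add: point_query_def)
  let ?ts = "interleave x (map (prover K x p) [0..<length x])"
  let ?is = "claimed_items x (num p) \<iota>"
  let ?cl = "map Annot (concat (map block (claims K x (num p) \<iota>)))"
  define d where "d i = (if i \<in> set ?is then freq x i - freq x i mod M else freq x i)" for i
  have ts: "?ts = Elem (hd x) # map Annot p @ map Elem (tl x) @ ?cl"
    using interleave_prover[OF xu(1,3)] \<iota> by simp
  have hd: "item (hd x) < n"
  proof (cases us)
    case (Cons e es)
    then show ?thesis using xu(1) xu(3)[of e] by auto
  qed (use xu in simp)
  have x_nonempty: "x \<noteq> []" using xu by simp
  have "foldl advance s0 (Elem (hd x) # map Annot p) = absorb (hd x) (Running (num p) (\<lambda>_. 0) None 0 1)"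
    using hd read_key[OF p] by (simp add: s0_def)
  also have "\<dots> = advance (Running (num p) (\<lambda>_. 0) None 0 1) (Elem (hd x))" by simp
  finally have "foldl advance s0 ?ts = foldl advance (Running (num p) (\<lambda>_. 0) None 0 1) (map Elem (hd x # tl x) @ ?cl)"
    unfolding ts by (simp add: foldl_append)
  also have "hd x # tl x = us @ [Query \<iota>]" using x_nonempty xu(1) \<iota> by simp
  also have "foldl advance (Running (num p) (\<lambda>_. 0) None 0 1) (map Elem (us @ [Query \<iota>]) @ ?cl) =
      foldl advance (Running (num p) (freq x) (Some \<iota>) 0 1) ?cl"
    using read_updates[OF xu(3)] xu(2) \<iota> fx by simp
  finally have fin: "foldl advance s0 ?ts = foldl advance (Running (num p) (freq x) (Some \<iota>) 0 1) ?cl" .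
  have "distinct ?is" "set ?is \<subseteq> {..<n}" by (auto simp: claimed_items_def)
  from read_claims[OF this, of "num p" "freq x" \<iota> 0 "freq x"]
  obtain v where v: "foldl advance s0 ?ts = Running (num p) d (Some \<iota>) v 1"
    using fin few unfolding d_def claims_def by auto
  have dvd: "M dvd d i" if "i < n" "hash (num p) i = hash (num p) \<iota>" for i
    using that by (auto simp: d_def claimed_items_def dvd_minus_mod)
  then have "M dvd (\<Sum>i | i < n \<and> hash (num p) i = hash (num p) \<iota>. d i * coeff r i)"
    by (intro dvd_sum) auto
  then have sk: "sketch r (num p) d (hash (num p) \<iota>) = 0" by (simp add: sketch_def)
  have "consistent x (foldl advance s0 ?ts)"
    using consistent_foldl[of ?ts] by (simp add: elems_interleave)
  then have "d \<iota> + v = freq x \<iota>" using v by simp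
  moreover have "M dvd d \<iota>" using dvd xu(2) \<iota> by simp
  ultimately have "v mod M = freq x \<iota> mod M"
    by (metis add.commute dvd_imp_mod_0 mod_add_right_eq add.right_neutral)
  then have "centered v = freq x \<iota>" by (rule centered_eq) (rule xu(4))
  then show ?thesis by (simp add: v sk pq)
qed

lemma length_claim_blocks: "length (concat (map block (claims K x a \<iota>))) \<le> K * L"
proof -
  have "length (block N) = L" if "N \<in> set (claims K x a \<iota>)" for N
  proof (rule block)
    from that obtain i where N: "N = i + n * nat (freq x i mod M)" and i: "i < n"
      by (auto simp: claims_def claimed_items_def split: if_splits)
    then show "N < 2 ^ L" using claim_less by simp
  qed
  then have "length (concat (map block (claims K x a \<iota>))) = length (claims K x a \<iota>) * L"
    by (simp add: length_concat comp_def sum_list_triv cong: map_cong)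
  also have "\<dots> \<le> K * L" by (intro mult_right_mono) (auto simp: claims_def)
  finally show ?thesis .
qed

lemma annotation_length:
  assumes "x \<in> pq_inputs n B" "length p = L"
  shows "(\<Sum>i<length x. length (prover K x p i)) \<le> L + K * L"
proof -
  from assms(1) obtain us \<iota> where xu: "x = us @ [Query \<iota>]"
    "\<And>e. e \<in> set us \<Longrightarrow> \<exists>i \<delta>. e = Update i \<delta> \<and> i < n"
    by (rule pq_inputs_cases) blast
  let ?ts = "interleave x (map (prover K x p) [0..<length x])"
  have upd: "length (prover K x p i) = (if i = 0 then L else 0)" if i: "i < length us" for i
  proof -
    have "x ! i = us ! i" using i xu by (simp add: nth_append)
    moreover obtain j \<delta> where "us ! i = Update j \<delta>" using xu(2)[OF nth_mem[OF i]] by blast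
    ultimately show ?thesis using assms by (simp add: prover_def)
  qed
  have "take (Suc (length us)) x = x" "x ! length us = Query \<iota>" by (simp_all add: xu(1))
  then have last: "length (prover K x p (length us)) \<le> (if length us = 0 then L else 0) + K * L"
    using length_claim_blocks[of K x "num p" \<iota>] assms(2) by (simp add: prover_def)
  have "(\<Sum>i<length x. length (prover K x p i)) =
      (\<Sum>i<length us. length (prover K x p i)) + length (prover K x p (length us))"
    by (simp add: xu(1))
  also have "\<dots> \<le> (\<Sum>i<length us. if i = 0 then L else 0) + ((if length us = 0 then L else 0) + K * L)"
    using last upd by (intro add_mono sum_mono) auto
  also have "\<dots> \<le> L + K * L" by (simp add: sum.delta)
  finally show ?thesis .
qed

section \<open>Assembly of the scheme and choice of parameters\<close>

lemma sketch_scheme: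
  assumes "0 < c" "min m n \<le> c * t"
  shows "\<exists>S :: (pq_elem, int) scheme. online_scheme S {x \<in> pq_inputs n B. sparsity x \<le> m} point_query
    (real (L + (15 * c + 1) * L)) (real (L * (t + 5)))"
proof -
  obtain start :: "bool list \<Rightarrow> bool list" and step :: "bool list \<Rightarrow> bool list \<Rightarrow> pq_elem token \<Rightarrow> bool list"
    and answer :: "bool list \<Rightarrow> bool list \<Rightarrow> int option"
    where mach: "\<And>r. start r \<in> bitstrings (L * (t + 5))"
    "\<And>r s t'. s \<in> bitstrings (L * (t + 5)) \<Longrightarrow> step r s t' \<in> bitstrings (L * (t + 5))"
    "\<And>r ts. answer r (foldl (step r) (start r) ts) = verdict r (foldl advance s0 ts)"
    using machine by blast
  \<comment> \<open>The bucket size that \<open>card_overfull_le\<close> guarantees for at least two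
    thirds of the keys.\<close>
  define K where "K = 15 * c + 1"
  define S :: "(pq_elem, int) scheme" where "S = \<lparr>prover_coins = L, verifier_coins = 2 * n, memory = L * (t + 5),
    annotation = prover K, start = start, step = step, answer = answer\<rparr>"
  let ?D = "{x \<in> pq_inputs n B. sparsity x \<le> m}"
  have sel: "prover_coins S = L" "verifier_coins S = 2 * n" "memory S = L * (t + 5)"
    "annotation S = prover K" by (simp_all add: S_def)
  have run: "run S r x as = verdict r (foldl advance s0 (interleave x as))" for r x as
    by (simp add: run_def S_def mach(3))
  have "respects_space S" using mach by (simp add: respects_space_def S_def)
  moreover have "online S ?D"
    unfolding online_def sel
  proof (intro ballI allI impI)
    fix x y :: "pq_elem list" and p i assume *: "i < length x \<and> i < length y \<and> take (Suc i) x = take (Suc i) y"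
    then have eq: "take (Suc i) x = take (Suc i) y" "x ! i = y ! i" by (simp, metis lessI nth_take)
    show "prover K x p i = prover K y p i" unfolding prover_def eq ..
  qed
  moreover have "annotation_length_le S ?D (real (L + (15 * c + 1) * L))"
    unfolding annotation_length_le_def sel
  proof (intro ballI)
    fix x p assume "x \<in> ?D" "p \<in> bitstrings L"
    then have "(\<Sum>i<length x. length (prover K x p i)) \<le> L + K * L"
      by (intro annotation_length) (auto simp: bitstrings_def)
    then show "real (\<Sum>i<length x. length (prover K x p i)) \<le> real (L + (15 * c + 1) * L)"
      unfolding K_def by (rule of_nat_mono)
  qed
  moreover have "soundness_error_le S ?D point_query (1/3)"
    unfolding soundness_error_le_def sel run prob_coins
  proof (intro ballI allI impI)
    fix x and as :: "bool list list" assume "x \<in> ?D" "length as = length x"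
    then have "4 * card {r \<in> bitstrings (2 * n).
      verdict r (foldl advance s0 (interleave x as)) \<notin> {Some (point_query x), None}} \<le> 2 ^ (2 * n)" (is "4 * ?c \<le> _")
      by (intro soundness) auto
    from of_nat_mono[OF this, where 'a = real] have "4 * real ?c \<le> 2 ^ (2 * n)" by simp
    then have "3 * real ?c \<le> 2 ^ (2 * n)" by linarith
    then show "real (card {r \<in> bitstrings (2 * n). r \<in> {r. verdict r (foldl advance s0 (interleave x as)) \<notin>
        {Some (point_query x), None}}}) / 2 ^ (2 * n) \<le> 1 / 3"
      by (simp add: field_simps)
  qed
  moreover have "completeness_error_le S ?D point_query (1/3)"
    unfolding completeness_error_le_def sel run honest_def prob_coins_pair
  proof (intro ballI)
    fix x assume x: "x \<in> ?D"
    then have "x \<in> pq_inputs n B" by simp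
    then obtain us \<iota> where xu: "x = us @ [Query \<iota>]" "\<iota> < n"
      "\<And>e. e \<in> set us \<Longrightarrow> \<exists>i \<delta>. e = Update i \<delta> \<and> i < n"
      by (rule pq_inputs_cases) blast
    define X where "X = {i. freq x i \<noteq> 0}"
    have Xn: "X \<subseteq> {..<n}"
    proof
      fix i assume "i \<in> X"
      then have "freq us i \<noteq> 0" by (simp add: X_def xu(1) freq_append freq_Cons)
      then show "i \<in> {..<n}" using freq_updates_eq_0[OF xu(3), where i = i] by force
    qed
    have fX: "finite X" using Xn finite_subset by blast
    have "card X \<le> n" using card_mono[OF _ Xn] by simp
    moreover have "card X \<le> m" using x by (simp add: sparsity_def X_def)
    ultimately have cX: "card X \<le> c * t" using assms(2) by linarith
    define bad where "bad = {a. a < 2 ^ L \<and> 15 * c + 1 < card {i \<in> X. hash a i = hash a \<iota>}}"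
    have bad: "3 * card bad \<le> 2 ^ L"
      unfolding bad_def by (rule card_overfull_le[OF fX Xn cX assms(1) xu(2) t L(1)])
    let ?E = "{z \<in> bitstrings L \<times> bitstrings (2 * n). z \<in> {(p, r).
        verdict r (foldl advance s0 (interleave x (map (prover K x p) [0..<length x]))) \<noteq> Some (point_query x)}}"
    let ?P = "{p \<in> bitstrings L. num p \<in> bad}"
    have "?E \<subseteq> ?P \<times> bitstrings (2 * n)"
    proof
      fix z assume z: "z \<in> ?E"
      obtain p r where zp: "z = (p, r)" by (cases z)
      from z have p: "p \<in> bitstrings L" and r: "r \<in> bitstrings (2 * n)"
        and wrong: "verdict r (foldl advance s0 (interleave x (map (prover K x p) [0..<length x]))) \<noteq> Some (point_query x)"
        unfolding zp by auto
      have pl: "length p = L" using p by (simp add: bitstrings_def)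
      have "length (claimed_items x (num p) \<iota>) = card (set (claimed_items x (num p) \<iota>))"
        by (rule distinct_card[symmetric]) (simp add: claimed_items_def)
      also have "set (claimed_items x (num p) \<iota>) = {i \<in> X. hash (num p) i = hash (num p) \<iota>}"
        using Xn by (auto simp: claimed_items_def X_def)
      finally have "\<not> card {i \<in> X. hash (num p) i = hash (num p) \<iota>} \<le> K"
        using completeness[of x \<iota> p K r] wrong x xu(1) pl by auto
      then show "z \<in> ?P \<times> bitstrings (2 * n)"
        using p r num_less[of p] pl by (simp add: zp bad_def K_def)
    qed
    then have "card ?E \<le> card (?P \<times> bitstrings (2 * n))" by (intro card_mono) auto
    also have "\<dots> = card ?P * 2 ^ (2 * n)" by (simp add: card_cartesian_product)
    also have "card ?P \<le> card bad"
      by (rule card_inj_on_le[of num])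
        (use bij_betw_num[of L] in \<open>auto simp: bij_betw_def bad_def intro: inj_on_subset\<close>)
    finally have "3 * card ?E \<le> (3 * card bad) * 2 ^ (2 * n)" by simp
    also have "\<dots> \<le> 2 ^ L * 2 ^ (2 * n)" using bad by (intro mult_right_mono) auto
    finally have "3 * card ?E \<le> 2 ^ L * 2 ^ (2 * n)" .
    from of_nat_mono[OF this, where 'a = real] have "3 * real (card ?E) \<le> 2 ^ L * 2 ^ (2 * n)" by simp
    then show "real (card ?E) / (2 ^ L * 2 ^ (2 * n)) \<le> 1 / 3" by (simp add: field_simps)
  qed
  ultimately have "online_scheme S ?D point_query (real (L + (15 * c + 1) * L)) (real (L * (t + 5)))"
    by (simp add: online_scheme_def sel)
  then show ?thesis by blast
qed

end

lemma online_scheme_mono: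
  assumes "online_scheme S D F a w" "a \<le> a'" "w \<le> w'"
  shows "online_scheme S D F a' w'"
  using assms unfolding online_scheme_def annotation_length_le_def
  by (auto intro: order_trans)

lemma pq_upper_bound:
  fixes k n m ca cv :: nat
  assumes n: "2 \<le> n" and ca: "0 < ca" and cv: "0 < cv" and m: "m \<le> ca * cv"
  shows "\<exists>S :: (pq_elem, int) scheme. online_scheme S {x \<in> pq_inputs n (n ^ k). sparsity x \<le> m} point_query
     (34 * real (k + 4) * (real ca * log 2 (real n))) (34 * real (k + 4) * (real cv * log 2 (real n)))"
proof -
  define l where "l = nat \<lceil>log 2 (real n)\<rceil>"
  \<comment> \<open>The exponent k + 4 leaves room for n * (6 n^k + 1), because 6 n^k + 1 \<le> 8
    n^k \<le> n^(k + 3).\<close>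
  define L where "L = l * (k + 4)"
  define t where "t = min cv n"
  have "log 2 2 \<le> log 2 (real n)" using n by (intro log_mono) auto
  then have "1 \<le> log 2 (real n)" by simp
  then have l: "log 2 (real n) \<le> real l" "real l \<le> 2 * log 2 (real n)" unfolding l_def by linarith+
  have "real n = 2 powr log 2 (real n)" using n by simp
  also have "\<dots> \<le> 2 powr real l" using l by (intro powr_mono) auto
  finally have "real n \<le> real (2 ^ l)" by (simp add: powr_realpow)
  then have "n \<le> 2 ^ l" by (simp only: of_nat_le_iff)
  then have nL: "n ^ (k + 4) \<le> 2 ^ L" unfolding L_def power_mult by (rule power_mono) simp
  have pos: "1 \<le> n ^ k" using n by simp
  have "2 ^ 3 \<le> n ^ 3" using n by (rule power_mono) simp
  then have n3: "8 \<le> n ^ 3" by simp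
  interpret pq_sketch n "n ^ k" t L
  proof
    show "2 \<le> n" "0 < t" "t \<le> n" using n cv by (auto simp: t_def)
    have "n ^ 2 \<le> n ^ (k + 4)" using n by (intro power_increasing) auto
    with nL show "n * n \<le> 2 ^ L" by (simp add: power2_eq_square)
    have "6 * n ^ k + 1 \<le> 8 * n ^ k" using pos by linarith
    also have "\<dots> \<le> n ^ 3 * n ^ k" using n3 by (rule mult_right_mono) simp
    finally have "n * (6 * n ^ k + 1) \<le> n * (n ^ 3 * n ^ k)" by (rule mult_left_mono) simp
    also have "\<dots> = n ^ (k + 4)" by (simp add: power_add power3_eq_cube power4_eq_xxxx mult_ac)
    finally show "n * (6 * n ^ k + 1) \<le> 2 ^ L" using nL by linarith
  qed
  \<comment> \<open>For cv > n only n buckets are used; they suffice since the support has at most n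
    items.\<close>
  have "min m n \<le> ca * t"
  proof (cases "cv \<le> n")
    case True
    then show ?thesis using m by (simp add: t_def)
  next
    case False
    then have "1 * n \<le> ca * t" using ca by (intro mult_mono) (auto simp: t_def)
    then show ?thesis by simp
  qed
  from sketch_scheme[OF ca this] obtain S :: "(pq_elem, int) scheme"
    where S: "online_scheme S {x \<in> pq_inputs n (n ^ k). sparsity x \<le> m} point_query
      (real (L + (15 * ca + 1) * L)) (real (L * (t + 5)))" by blast
  have "real L = real (k + 4) * real l" by (simp add: L_def)
  also have "\<dots> \<le> real (k + 4) * (2 * log 2 (real n))" using l by (intro mult_left_mono) auto
  finally have rL: "real L \<le> real (k + 4) * (2 * log 2 (real n))" .
  \<comment> \<open>34 = 2 * 17: rounding log n up costs a factor 2, and 15 ca + 2 and t + 5 are at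
    most 17 ca and 17 cv.\<close>
  have bound: "real (L * e) \<le> 34 * real (k + 4) * (real c * log 2 (real n))" if "e \<le> 17 * c" for e c :: nat
  proof -
    have "real L * real e \<le> real (k + 4) * (2 * log 2 (real n)) * real (17 * c)"
      using that n by (intro mult_mono rL) auto
    then show ?thesis by (simp add: algebra_simps)
  qed
  have eq: "L + (15 * ca + 1) * L = L * (15 * ca + 2)" by (simp add: algebra_simps)
  have "real (L * (15 * ca + 2)) \<le> 34 * real (k + 4) * (real ca * log 2 (real n))"
    by (rule bound) (use ca in linarith)
  moreover have "real (L * (t + 5)) \<le> 34 * real (k + 4) * (real cv * log 2 (real n))"
    by (rule bound) (use cv in \<open>simp add: t_def\<close>)
  ultimately show ?thesis using S unfolding eq by (blast intro: online_scheme_mono)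
qed

theorem theorem3p2:
  "(\<forall>k::nat. \<exists>C::real. C > 0 \<and>
      (\<forall>(n::nat) (m::nat) (ca::nat) (cv::nat).
         n \<ge> 2 \<and> ca > 0 \<and> cv > 0 \<and> ca * cv \<ge> m \<longrightarrow>
         (\<exists>S :: (pq_elem, int) scheme.
            online_scheme S {x \<in> pq_inputs n (n ^ k). sparsity x \<le> m} point_query
              (C * (real ca * log 2 (real n))) (C * (real cv * log 2 (real n)))))) \<and>
   (\<exists>c::real. c > 0 \<and>
      (\<forall>(k::nat) (n::nat) (m::nat) (ca::real) (cv::real) (S :: (pq_elem, int) scheme).
         1 \<le> m \<and> m \<le> n \<and> ca \<ge> log 2 (real n) \<and>
         online_scheme S {x \<in> pq_inputs n (n ^ k). sparsity x = m} point_query ca cv \<longrightarrow>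
         ca * cv \<ge> c * (real m * log 2 (real n / real m))))"
proof (rule conjI)
  show "\<forall>k::nat. \<exists>C::real. C > 0 \<and> (\<forall>(n::nat) (m::nat) (ca::nat) (cv::nat).
      n \<ge> 2 \<and> ca > 0 \<and> cv > 0 \<and> ca * cv \<ge> m \<longrightarrow>
      (\<exists>S :: (pq_elem, int) scheme. online_scheme S {x \<in> pq_inputs n (n ^ k). sparsity x \<le> m} point_query
         (C * (real ca * log 2 (real n))) (C * (real cv * log 2 (real n)))))"
  proof
    fix k :: nat
    show "\<exists>C::real. C > 0 \<and> (\<forall>(n::nat) (m::nat) (ca::nat) (cv::nat).
        n \<ge> 2 \<and> ca > 0 \<and> cv > 0 \<and> ca * cv \<ge> m \<longrightarrow>
        (\<exists>S :: (pq_elem, int) scheme. online_scheme S {x \<in> pq_inputs n (n ^ k). sparsity x \<le> m} point_query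
           (C * (real ca * log 2 (real n))) (C * (real cv * log 2 (real n)))))"
      by (rule exI[of _ "34 * real (k + 4)"]) (use pq_upper_bound in \<open>simp del: of_nat_add\<close>)
  qed
qed (rule exI[of _ "1 / 1056"], use pq_lower_bound in auto)

end
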